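(* Let $z\in\Xi$, $M>0$ and $N\ge 0$. Assume that the eigenspace $U^{(M)}_2(\xi(-N,z))$ and the subspace $W_2^{(M,N)}(z)$ are one-dimensional. Then $$\|\hat f_{n,\xi(\delta,z),M,N+\delta}-\hat f_{n,z,M,N}\|_1\to 0\quad\text{as }\delta\to 0,\ \delta>0.$$
   Context: Setting. $\mathcal M\subset\mathbb R^D$ is a smooth compact $d$-dimensional manifold ($D\ge d$), and $m$ is normalised Lebesgue (volume) measure on $\mathcal M$. $\|\cdot\|_1$ is the norm of $L^1(\mathcal M,m)$. (The letter $M$ denotes a flow duration, not the manifold.) Driving system. $\Xi\subset\mathbb R^{d_1}$, $d_1\ge 3$, and $\xi:\mathbb R\times\Xi\to\Xi$ is the flow of an autonomous ODE $\dot z=g(z)$ on $\Xi$. It preserves a probability measure $\mathbb P$ on $\Xi$ and is ergodic with respect to it. Nonautonomous flow. $F$ is a vector field on $\mathcal M$ depending on $z\in\Xi$, and $\phi:\mathbb R\times\Xi\times\mathcal M\to\mathcal M$ is the flow of $\dot x(t)=F(\xi(t,z),x(t))$, i.e. $\frac{d}{dt}\phi(t,z,x)=F(\xi(t,z),\phi(t,z,x))$ and $\phi(0,z,x)=x$. It satisfies $\phi(t+s,z,x)=\phi(t,\xi(s,z),\phi(s,z,x))$. $F$ is assumed regular enough that classical solutions exist for all times, and that for each fixed $z$ the maps $\phi(t,z,\cdot)$ are $C^1$ diffeomorphisms of $\mathcal M$, with $\phi(t,z,x)$ and its derivative $D\phi(t,z,x)$ in $x$ continuous in $(t,x)$. Perron–Frobenius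 operators. For $t\ge 0$, $z\in\Xi$ and $f\in L^1(\mathcal M,m)$, $$\mathcal P_z^{(t)}f(x)=f(\phi(-t,\xi(t,z),x))\cdot|\det D\phi(-t,\xi(t,z),x)|.$$ Projection and matrices. $\{B_1,\dots,B_n\}$ is a fixed partition of $\mathcal M$ into connected sets of positive Lebesgue measure. $\mathcal B_n$ is the linear span of $\chi_{B_1},\dots,\chi_{B_n}$. The projection $\pi_n:L^1(\mathcal M,m)\to\mathcal B_n$ is $\pi_nf=\sum_{i=1}^n\frac{\int_{B_i}f\,dm}{m(B_i)}\chi_{B_i}$. For $t\ge0$, $P^{(t)}(z)$ is the $n\times n$ matrix of the restriction of $\pi_n\mathcal P_z^{(t)}$ to $\mathcal B_n$ in the basis $\chi_{B_1},\dots,\chi_{B_n}$ (acting on column vectors of coefficients): $P^{(t)}(z)_{ij}=m(B_j\cap\phi(-t,\xi(t,z),B_i))/m(B_i)$. Approximate Oseledets functions. For $M>0$ and $y\in\Xi$ put $\Psi^{(M)}(y)=\left(P^{(M)}(y)^\top P^{(M)}(y)\right)^{1/2M}$. Let $U_2^{(M)}(y)\subset\mathbb R^n$ be the eigenspace of $\Psi^{(M)}(y)$ for its second largest eigenvalue (eigenvalues counted with multiplicity, so that $U_2^{(M)}(y)$ is spanned by the second right singular vector of $P^{(M)}(y)$ when it is one-dimensional). For $N\ge 0$ put $W_2^{(M,N)}(z)=P^{(N)}(\xi(-N,z))\,U_2^{(M)}(\xi(-N,z))$. When $U_2^{(M)}(y)$ is one-dimensional, fix once and for all a vector $u_2^{(M)}(y)\in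 U_2^{(M)}(y)$, scaled so that $f_{n,y,M}:=\sum_{i=1}^n(u_2^{(M)}(y))_i\,\chi_{B_i}$ satisfies $\|f_{n,y,M}\|_1=1$. Then define, for $N\ge0$, $$\hat f_{n,z,M,N}:=\pi_n\mathcal P^{(N)}_{\xi(-N,z)}f_{n,\xi(-N,z),M}.$$ In particular $\hat f_{n,\xi(\delta,z),M,N+\delta}=\pi_n\mathcal P^{(N+\delta)}_{\xi(-N,z)}f_{n,\xi(-N,z),M}$, since $\xi(-(N+\delta),\xi(\delta,z))=\xi(-N,z)$. *)

theory Defs
  imports "HOL-Probability.Probability"
begin

text \<open>Regularity of class \<open>C^k\<close> on an open set, by iterated directional derivatives.\<close>

primrec C_k_on :: "nat \<Rightarrow> ('a::euclidean_space \<Rightarrow> 'b::euclidean_space) \<Rightarrow> 'a set \<Rightarrow> bool" where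
  "C_k_on 0 f S \<longleftrightarrow> continuous_on S f"
| "C_k_on (Suc k) f S \<longleftrightarrow> (\<forall>x\<in>S. f differentiable (at x)) \<and>
     (\<forall>v. C_k_on k (\<lambda>x. frechet_derivative f (at x) v) S)"

definition smooth_on :: "'a::euclidean_space set \<Rightarrow> ('a \<Rightarrow> 'b::euclidean_space) \<Rightarrow> bool" where
  "smooth_on S f \<longleftrightarrow> (\<forall>k. C_k_on k f S)"

definition local_parametrization ::
  "'a::euclidean_space set \<Rightarrow> (real^'d) set \<Rightarrow> (real^'d \<Rightarrow> 'a) \<Rightarrow> bool" where
  "local_parametrization X U \<psi> \<longleftrightarrow>
     open U \<and> smooth_on U \<psi> \<and> (\<forall>u\<in>U. inj (frechet_derivative \<psi> (at u))) \<and>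
     openin (top_of_set X) (\<psi> ` U) \<and> (\<exists>\<psi>'. homeomorphism U (\<psi> ` U) \<psi> \<psi>')"

text \<open>Embedded, without boundary, of dimension \<open>CARD('d)\<close>; the dimension is passed as a type.\<close>

definition compact_smooth_manifold :: "'d::finite itself \<Rightarrow> 'a::euclidean_space set \<Rightarrow> bool" where
  "compact_smooth_manifold _ X \<longleftrightarrow> compact X \<and>
     (\<forall>x\<in>X. \<exists>(U::(real^'d) set) \<psi>. local_parametrization X U \<psi> \<and> x \<in> \<psi> ` U)"

definition tangent_space :: "'a::euclidean_space set \<Rightarrow> 'a \<Rightarrow> 'a set" where
  "tangent_space X x = {v. \<exists>\<gamma> \<epsilon>. \<epsilon> > 0 \<and> (\<forall>t::real. \<bar>t\<bar> < \<epsilon> \<longrightarrow> \<gamma> t \<in> X) \<and> \<gamma> 0 = x \<and>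
     (\<gamma> has_vector_derivative v) (at 0)}"

definition tangent_bundle :: "'a::euclidean_space set \<Rightarrow> ('a \<times> 'a) set" where
  "tangent_bundle X = {(x, v). x \<in> X \<and> v \<in> tangent_space X x}"

text \<open>
  For a self-map \<open>f\<close> of a submanifold \<open>X\<close>, the linear map
  \<open>frechet_derivative f (at x within X)\<close> is determined only on the tangent space at \<open>x\<close>
  (off it, it is an arbitrary choice).  So derivatives on \<open>X\<close> are only ever evaluated at
  tangent vectors below.
\<close>

definition C1_on_manifold :: "'a::euclidean_space set \<Rightarrow> ('a \<Rightarrow> 'a) \<Rightarrow> bool" where
  "C1_on_manifold X f \<longleftrightarrow> (\<forall>x\<in>X. f differentiable (at x within X)) \<and>
     continuous_on (tangent_bundle X) (\<lambda>(x, v). frechet_derivative f (at x within X) v)"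

definition C1_diffeomorphism :: "'a::euclidean_space set \<Rightarrow> ('a \<Rightarrow> 'a) \<Rightarrow> bool" where
  "C1_diffeomorphism X f \<longleftrightarrow>
     bij_betw f X X \<and> C1_on_manifold X f \<and> C1_on_manifold X (inv_into X f)"

text \<open>
  The absolute determinant of the derivative, as a map between the tangent spaces at \<open>x\<close> and
  \<open>f x\<close>, is taken with respect to orthonormal bases; it does not depend on their choice.
\<close>

definition orthonormal_frame :: "'a::euclidean_space set \<Rightarrow> ('d::finite \<Rightarrow> 'a) \<Rightarrow> bool" where
  "orthonormal_frame T e \<longleftrightarrow> (\<forall>i j. e i \<bullet> e j = (if i = j then 1 else 0)) \<and> span (range e) = T"

definition tangent_frame :: "'a::euclidean_space set \<Rightarrow> 'a \<Rightarrow> 'd::finite \<Rightarrow> 'a" where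
  "tangent_frame X x = (SOME e. orthonormal_frame (tangent_space X x) e)"

definition abs_det_deriv ::
  "'d::finite itself \<Rightarrow> 'a::euclidean_space set \<Rightarrow> ('a \<Rightarrow> 'a) \<Rightarrow> 'a \<Rightarrow> real" where
  "abs_det_deriv _ X f x =
     \<bar>det (\<chi> i j. tangent_frame X (f x) i \<bullet>
            frechet_derivative f (at x within X) (tangent_frame X x j) :: real^'d^'d)\<bar>"

text \<open>
  The volume measure is the Borel measure on \<open>X\<close> given in every parametrization by the density
  \<open>sqrt (det (D\<psi>\<^sup>T D\<psi>))\<close>; parametrized pieces cover \<open>X\<close>, so it is unique.
  The normalised measure is completed, in analogy with \<^const>\<open>lebesgue\<close>.
\<close>

definition volume_density :: "(real^'d \<Rightarrow> 'a::euclidean_space) \<Rightarrow> real^'d \<Rightarrow> real" where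
  "volume_density \<psi> u =
     sqrt (det (\<chi> i j. frechet_derivative \<psi> (at u) (axis i 1) \<bullet>
                        frechet_derivative \<psi> (at u) (axis j 1) :: real^'d^'d))"

definition volume_measure ::
  "'d::finite itself \<Rightarrow> 'a::euclidean_space set \<Rightarrow> 'a measure \<Rightarrow> bool" where
  "volume_measure _ X \<nu> \<longleftrightarrow> space \<nu> = X \<and> sets \<nu> = sets (restrict_space borel X) \<and>
     (\<forall>(U::(real^'d) set) \<psi> A. local_parametrization X U \<psi> \<and> A \<in> sets borel \<and> A \<subseteq> U \<longrightarrow>
        emeasure \<nu> (\<psi> ` A) = (\<integral>\<^sup>+u\<in>A. ennreal (volume_density \<psi> u) \<partial>lborel))"

definition normalised_volume ::
  "'d::finite itself \<Rightarrow> 'a::euclidean_space set \<Rightarrow> 'a measure \<Rightarrow> bool" where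
  "normalised_volume d X m \<longleftrightarrow>
     (\<exists>\<nu>. volume_measure d X \<nu> \<and> m = completion (uniform_measure \<nu> X))"

definition L1_norm :: "'a measure \<Rightarrow> ('a \<Rightarrow> real) \<Rightarrow> real" where
  "L1_norm m f = (LINT x|m. \<bar>f x\<bar>)"

definition autonomous_flow ::
  "'z::euclidean_space set \<Rightarrow> ('z \<Rightarrow> 'z) \<Rightarrow> (real \<Rightarrow> 'z \<Rightarrow> 'z) \<Rightarrow> bool" where
  "autonomous_flow \<Xi> g \<xi> \<longleftrightarrow>
     (\<forall>t. \<forall>z\<in>\<Xi>. \<xi> t z \<in> \<Xi>) \<and>
     (\<forall>z\<in>\<Xi>. \<xi> 0 z = z) \<and>
     (\<forall>s t. \<forall>z\<in>\<Xi>. \<xi> (t + s) z = \<xi> t (\<xi> s z)) \<and>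
     (\<forall>t. \<forall>z\<in>\<Xi>. ((\<lambda>\<tau>. \<xi> \<tau> z) has_vector_derivative g (\<xi> t z)) (at t))"

definition measure_preserving_flow :: "'z measure \<Rightarrow> (real \<Rightarrow> 'z \<Rightarrow> 'z) \<Rightarrow> bool" where
  "measure_preserving_flow P \<xi> \<longleftrightarrow> (\<forall>t. \<xi> t \<in> measurable P P \<and> distr P P (\<xi> t) = P)"

definition ergodic_flow :: "'z measure \<Rightarrow> (real \<Rightarrow> 'z \<Rightarrow> 'z) \<Rightarrow> bool" where
  "ergodic_flow P \<xi> \<longleftrightarrow>
     (\<forall>A\<in>sets P. (\<forall>t. \<xi> t -` A \<inter> space P = A) \<longrightarrow> measure P A = 0 \<or> measure P A = 1)"

definition driving_system ::
  "'z::euclidean_space set \<Rightarrow> ('z \<Rightarrow> 'z) \<Rightarrow> (real \<Rightarrow> 'z \<Rightarrow> 'z) \<Rightarrow> 'z measure \<Rightarrow> bool" where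
  "driving_system \<Xi> g \<xi> P \<longleftrightarrow> autonomous_flow \<Xi> g \<xi> \<and>
     prob_space P \<and> space P = \<Xi> \<and> sets P = sets (restrict_space borel \<Xi>) \<and>
     measure_preserving_flow P \<xi> \<and> ergodic_flow P \<xi>"

definition nonautonomous_flow ::
  "'a::euclidean_space set \<Rightarrow> 'z set \<Rightarrow> (real \<Rightarrow> 'z \<Rightarrow> 'z) \<Rightarrow> ('z \<Rightarrow> 'a \<Rightarrow> 'a) \<Rightarrow>
     (real \<Rightarrow> 'z \<Rightarrow> 'a \<Rightarrow> 'a) \<Rightarrow> bool" where
  "nonautonomous_flow X \<Xi> \<xi> F \<phi> \<longleftrightarrow>
     (\<forall>z\<in>\<Xi>. \<forall>x\<in>X. F z x \<in> tangent_space X x) \<and>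
     (\<forall>t. \<forall>z\<in>\<Xi>. \<forall>x\<in>X. \<phi> t z x \<in> X) \<and>
     (\<forall>z\<in>\<Xi>. \<forall>x\<in>X. \<phi> 0 z x = x) \<and>
     (\<forall>t. \<forall>z\<in>\<Xi>. \<forall>x\<in>X.
        ((\<lambda>\<tau>. \<phi> \<tau> z x) has_vector_derivative F (\<xi> t z) (\<phi> t z x)) (at t)) \<and>
     (\<forall>s t. \<forall>z\<in>\<Xi>. \<forall>x\<in>X. \<phi> (t + s) z x = \<phi> t (\<xi> s z) (\<phi> s z x)) \<and>
     (\<forall>t. \<forall>z\<in>\<Xi>. C1_diffeomorphism X (\<phi> t z)) \<and>
     (\<forall>z\<in>\<Xi>. continuous_on (UNIV \<times> X) (\<lambda>(t, x). \<phi> t z x)) \<and>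
     (\<forall>z\<in>\<Xi>. continuous_on (UNIV \<times> tangent_bundle X)
        (\<lambda>(t, x, v). frechet_derivative (\<phi> t z) (at x within X) v))"

definition perron_frobenius ::
  "'d::finite itself \<Rightarrow> 'a::euclidean_space set \<Rightarrow> (real \<Rightarrow> 'z \<Rightarrow> 'z) \<Rightarrow>
     (real \<Rightarrow> 'z \<Rightarrow> 'a \<Rightarrow> 'a) \<Rightarrow> real \<Rightarrow> 'z \<Rightarrow> ('a \<Rightarrow> real) \<Rightarrow> 'a \<Rightarrow> real" where
  "perron_frobenius d X \<xi> \<phi> t z f x =
     f (\<phi> (- t) (\<xi> t z) x) * abs_det_deriv d X (\<phi> (- t) (\<xi> t z)) x"

text \<open>A partition into \<open>n\<close> sets is indexed by a finite type with \<open>n\<close> elements.\<close>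

definition connected_partition :: "'a::euclidean_space set \<Rightarrow> 'a measure \<Rightarrow> ('n::finite \<Rightarrow> 'a set) \<Rightarrow> bool" where
  "connected_partition X m B \<longleftrightarrow> disjoint_family B \<and> (\<Union>i. B i) = X \<and>
     (\<forall>i. connected (B i) \<and> B i \<in> sets m \<and> measure m (B i) > 0)"

definition step_function :: "('n::finite \<Rightarrow> 'a set) \<Rightarrow> real^'n \<Rightarrow> 'a \<Rightarrow> real" where
  "step_function B c x = (\<Sum>i\<in>UNIV. c $ i * indicator (B i) x)"

definition step_projection ::
  "'a measure \<Rightarrow> ('n::finite \<Rightarrow> 'a set) \<Rightarrow> ('a \<Rightarrow> real) \<Rightarrow> 'a \<Rightarrow> real" where
  "step_projection m B f =
     step_function B (\<chi> i. (LINT x:B i|m. f x) / measure m (B i))"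

text \<open>
  The matrix of \<open>step_projection m B \<circ> perron_frobenius d X \<xi> \<phi> t z\<close> on step functions, in the
  basis of indicator functions; the entries are in the form obtained by change of variables.
\<close>

definition transition_matrix ::
  "'a measure \<Rightarrow> ('n::finite \<Rightarrow> 'a set) \<Rightarrow> (real \<Rightarrow> 'z \<Rightarrow> 'z) \<Rightarrow>
     (real \<Rightarrow> 'z \<Rightarrow> 'a \<Rightarrow> 'a) \<Rightarrow> real \<Rightarrow> 'z \<Rightarrow> real^'n^'n" where
  "transition_matrix m B \<xi> \<phi> t z =
     (\<chi> i j. measure m (B j \<inter> \<phi> (- t) (\<xi> t z) ` B i) / measure m (B i))"

definition diagonal_mat :: "('n \<Rightarrow> real) \<Rightarrow> real^'n^'n" where
  "diagonal_mat d = (\<chi> i j. if i = j then d i else 0)"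

text \<open>
  Real power of a symmetric positive semidefinite matrix: the result is the same for every
  orthogonal diagonalization of \<open>A\<close>.  Note \<open>0 powr s = 0\<close>.
\<close>

definition matrix_powr :: "real^'n^'n \<Rightarrow> real \<Rightarrow> real^'n^'n" where
  "matrix_powr A s = (THE R. \<exists>Q d. orthogonal_matrix Q \<and>
     A = Q ** diagonal_mat d ** transpose Q \<and>
     R = Q ** diagonal_mat (\<lambda>i. d i powr s) ** transpose Q)"

definition eigenspace :: "real^'n^'n \<Rightarrow> real \<Rightarrow> (real^'n) set" where
  "eigenspace A \<mu> = {v. A *v v = \<mu> *\<^sub>R v}"

text \<open>
  The eigenvalues of a symmetric matrix in decreasing order, repeated according to multiplicity
  (geometric and algebraic multiplicities agree).
\<close>

definition eigenvalue_list :: "real^'n^'n \<Rightarrow> real list" where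
  "eigenvalue_list A =
     (THE xs. sorted_wrt (\<ge>) xs \<and> (\<forall>\<mu>. count_list xs \<mu> = dim (eigenspace A \<mu>)))"

text \<open>The list is indexed from 0.  A second eigenvalue exists only in dimension at least 2.\<close>

definition second_eigenvalue :: "real^'n^'n \<Rightarrow> real" where
  "second_eigenvalue A = eigenvalue_list A ! 1"

definition Psi ::
  "'a measure \<Rightarrow> ('n::finite \<Rightarrow> 'a set) \<Rightarrow> (real \<Rightarrow> 'z \<Rightarrow> 'z) \<Rightarrow>
     (real \<Rightarrow> 'z \<Rightarrow> 'a \<Rightarrow> 'a) \<Rightarrow> real \<Rightarrow> 'z \<Rightarrow> real^'n^'n" where
  "Psi m B \<xi> \<phi> M y =
     matrix_powr (transpose (transition_matrix m B \<xi> \<phi> M y) ** transition_matrix m B \<xi> \<phi> M y)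
       (1 / (2 * M))"

definition U2 ::
  "'a measure \<Rightarrow> ('n::finite \<Rightarrow> 'a set) \<Rightarrow> (real \<Rightarrow> 'z \<Rightarrow> 'z) \<Rightarrow>
     (real \<Rightarrow> 'z \<Rightarrow> 'a \<Rightarrow> 'a) \<Rightarrow> real \<Rightarrow> 'z \<Rightarrow> (real^'n) set" where
  "U2 m B \<xi> \<phi> M y = eigenspace (Psi m B \<xi> \<phi> M y) (second_eigenvalue (Psi m B \<xi> \<phi> M y))"

definition W2 ::
  "'a measure \<Rightarrow> ('n::finite \<Rightarrow> 'a set) \<Rightarrow> (real \<Rightarrow> 'z \<Rightarrow> 'z) \<Rightarrow>
     (real \<Rightarrow> 'z \<Rightarrow> 'a \<Rightarrow> 'a) \<Rightarrow> real \<Rightarrow> real \<Rightarrow> 'z \<Rightarrow> (real^'n) set" where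
  "W2 m B \<xi> \<phi> M N z =
     (\<lambda>v. transition_matrix m B \<xi> \<phi> N (\<xi> (- N) z) *v v) ` U2 m B \<xi> \<phi> M (\<xi> (- N) z)"

text \<open>
  A choice \<open>u\<close> of a vector \<open>u M y\<close> in each one-dimensional \<open>U2\<close>, normalised in the L1 norm of the
  associated step function.  It is unique up to sign.
\<close>

definition normalised_choice ::
  "'z set \<Rightarrow> 'a measure \<Rightarrow> ('n::finite \<Rightarrow> 'a set) \<Rightarrow> (real \<Rightarrow> 'z \<Rightarrow> 'z) \<Rightarrow>
     (real \<Rightarrow> 'z \<Rightarrow> 'a \<Rightarrow> 'a) \<Rightarrow> (real \<Rightarrow> 'z \<Rightarrow> real^'n) \<Rightarrow> bool" where
  "normalised_choice \<Xi> m B \<xi> \<phi> u \<longleftrightarrow>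
     (\<forall>M>0. \<forall>y\<in>\<Xi>. dim (U2 m B \<xi> \<phi> M y) = 1 \<longrightarrow>
        u M y \<in> U2 m B \<xi> \<phi> M y \<and> L1_norm m (step_function B (u M y)) = 1)"

definition f_hat ::
  "'d::finite itself \<Rightarrow> 'a::euclidean_space set \<Rightarrow> 'a measure \<Rightarrow> ('n::finite \<Rightarrow> 'a set) \<Rightarrow>
     (real \<Rightarrow> 'z \<Rightarrow> 'z) \<Rightarrow> (real \<Rightarrow> 'z \<Rightarrow> 'a \<Rightarrow> 'a) \<Rightarrow> (real \<Rightarrow> 'z \<Rightarrow> real^'n) \<Rightarrow>
     'z \<Rightarrow> real \<Rightarrow> real \<Rightarrow> 'a \<Rightarrow> real" where
  "f_hat d X m B \<xi> \<phi> u z M N =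
     step_projection m B
       (perron_frobenius d X \<xi> \<phi> N (\<xi> (- N) z) (step_function B (u M (\<xi> (- N) z))))"

end

theory Submission
  imports Defs
begin

text \<open>
  Put \<open>y = \<xi> (- N) z\<close>.  Since \<open>\<xi> (- (N + \<delta>)) (\<xi> \<delta> z) = y\<close> for every \<open>\<delta>\<close>, both functions in the claim are
  obtained from one and the same step function \<open>f\<close>, chosen at \<open>y\<close>, by pushing it forward for the times
  \<open>N + \<delta>\<close> and \<open>N\<close> and projecting.  With \<open>g t = \<phi> (- t) (\<xi> t y)\<close>, the inverse of \<open>\<phi> t y\<close>, and its
  absolute Jacobian \<open>J t\<close>, the coefficients after time \<open>t\<close> are the averages over the sets \<open>B i\<close> of
  \<open>f (g t x) * J t x\<close>.  A step function depends continuously in the L1 norm on its finitely many coefficients (\<open>L1_norm_step_function_diff_le\<close>), so it is enough that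
  these integrals are continuous in \<open>t\<close> when \<open>f\<close> is the indicator of a measurable set \<open>A\<close>
  (\<open>transported_set_integral\<close>).

  An indicator is discontinuous, and the boundary of \<open>A\<close> may have positive measure, so
  pointwise convergence of the integrands almost everywhere is not clear.  The indicator is therefore replaced by a
  continuous function that agrees with it outside a small set \<open>E\<close>.  Two facts make this work.

  First, \<open>(t, x) \<mapsto> g t x\<close> and \<open>(t, x) \<mapsto> J t x\<close> are jointly continuous, so that the integrals for the
  continuous replacement are continuous in \<open>t\<close>.  The assumptions give joint continuity only for
  \<open>\<phi> t y\<close> and its derivative.  For \<open>g\<close> it follows by compactness (\<open>continuous_on_inverse_family\<close>), and
  \<open>J t x\<close> is the reciprocal of the Jacobian of \<open>\<phi> t y\<close> at \<open>g t x\<close> (\<open>abs_det_deriv_inverse\<close>).  The Jacobian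
  is defined through arbitrarily chosen orthonormal frames; its continuity (\<open>abs_det_deriv_continuous\<close>)
  rests on a formula by Gram determinants in a parametrization, where no frame occurs.

  Second, the error is controlled uniformly in \<open>t\<close>: it lives on \<open>\<phi> t y ` E\<close>, and there is a constant \<open>C\<close>
  with \<open>m (\<phi> t y ` E) \<le> C * m E\<close> for all \<open>t\<close> in a compact interval and all Borel sets \<open>E\<close>
  (\<open>volume_image_bound\<close>).
  The reason is that in parametrizations the maps \<open>\<phi> t y\<close> are locally Lipschitz with uniform constants,
  and a Lipschitz map enlarges Lebesgue measure by at most a constant factor
  (\<open>measure_lipschitz_image_le\<close>).
\<close>

section \<open>Orthonormal frames and Gram determinants\<close>

definition gram :: "('d::finite \<Rightarrow> 'a::euclidean_space) \<Rightarrow> real^'d^'d" where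
  "gram a = (\<chi> i j. a i \<bullet> a j)"

definition coords :: "('d::finite \<Rightarrow> 'a::euclidean_space) \<Rightarrow> ('d \<Rightarrow> 'a) \<Rightarrow> real^'d^'d" where
  "coords e a = (\<chi> i j. e i \<bullet> a j)"

lemma orthonormal_frame_exists:
  fixes T :: "'a::euclidean_space set"
  assumes "subspace T" and "dim T = CARD('d::finite)"
  shows "\<exists>e::'d::finite \<Rightarrow> 'a. orthonormal_frame T e"
proof -
  obtain C where C: "C \<subseteq> T" "pairwise orthogonal C" "\<And>x. x \<in> C \<Longrightarrow> norm x = 1"
    "independent C" "card C = dim T" "span C = T"
    using orthonormal_basis_subspace[OF assms(1)] by metis
  have "finite C" using C(4) independent_imp_finite by blast
  then obtain e :: "'d \<Rightarrow> 'a" where e: "bij_betw e UNIV C"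
    using C(5) assms(2) bij_betw_iff_card[of "UNIV::'d set" C] by auto
  have "e i \<bullet> e j = (if i = j then 1 else 0)" for i j
  proof (cases "i = j")
    case True
    then show ?thesis using C(3)[of "e i"] e by (auto simp: bij_betw_def norm_eq_1)
  next
    case False
    then have "e i \<noteq> e j" "e i \<in> C" "e j \<in> C" using e by (auto simp: bij_betw_def inj_on_def)
    then show ?thesis using C(2) False by (auto simp: pairwise_def orthogonal_def)
  qed
  moreover have "span (range e) = T" using C(6) e by (simp add: bij_betw_def)
  ultimately have "orthonormal_frame T e" unfolding orthonormal_frame_def by blast
  then show ?thesis by blast
qed

lemma orthonormal_frame_expansion:
  assumes e: "orthonormal_frame T e" and v: "v \<in> T"
  shows "v = (\<Sum>k\<in>UNIV. (e k \<bullet> v) *\<^sub>R e k)"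
proof -
  have T: "T = span (range e)" and o: "\<And>i j. e i \<bullet> e j = (if i = j then 1 else 0)"
    using e by (auto simp: orthonormal_frame_def)
  have "v \<in> span (range e)" using v T by simp
  then show ?thesis
  proof (induction rule: span_induct_alt)
    case base
    then show ?case by simp
  next
    case (step c x y)
    then obtain i where i: "x = e i" by auto
    have *: "(\<Sum>k\<in>UNIV. (e k \<bullet> x) *\<^sub>R e k) = x"
      unfolding i o by (simp add: if_distrib[of "\<lambda>r. r *\<^sub>R _"] cong: if_cong)
    have "(\<Sum>k\<in>UNIV. (e k \<bullet> (c *\<^sub>R x + y)) *\<^sub>R e k)
        = c *\<^sub>R (\<Sum>k\<in>UNIV. (e k \<bullet> x) *\<^sub>R e k) + (\<Sum>k\<in>UNIV. (e k \<bullet> y) *\<^sub>R e k)"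
      by (simp add: inner_add_right scaleR_add_left sum.distrib scaleR_sum_right)
    then show ?case using * step by metis
  qed
qed

lemma orthonormal_frame_inner:
  assumes e: "orthonormal_frame T e" and v: "v \<in> T"
  shows "v \<bullet> w = (\<Sum>k\<in>UNIV. (e k \<bullet> v) * (e k \<bullet> w))"
proof -
  have "v \<bullet> w = (\<Sum>k\<in>UNIV. (e k \<bullet> v) *\<^sub>R e k) \<bullet> w"
    using orthonormal_frame_expansion[OF e v] by metis
  then show ?thesis by (simp add: inner_sum_left)
qed

lemma orthonormal_frame_in: "orthonormal_frame T e \<Longrightarrow> e k \<in> T"
  unfolding orthonormal_frame_def by (metis rangeI span_base)

lemma gram_eq_coords:
  assumes "orthonormal_frame T e" and "range a \<subseteq> T"
  shows "gram a = transpose (coords e a) ** coords e a"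
proof -
  have "a i \<bullet> a j = (\<Sum>k\<in>UNIV. (e k \<bullet> a i) * (e k \<bullet> a j))" for i j
    using assms by (intro orthonormal_frame_inner[of T]) auto
  then show ?thesis
    by (simp add: gram_def coords_def vec_eq_iff matrix_matrix_mult_def transpose_def)
qed

text \<open>
The Gram determinant sees only inner products, so it needs no frame, whereas \<^const>\<open>abs_det_deriv\<close>
is written in frames that are picked by choice and may vary discontinuously from point to point.
This identity removes the frames from the formula for the Jacobian.
\<close>

lemma det_gram:
  assumes "orthonormal_frame T e" and "range a \<subseteq> T"
  shows "sqrt (det (gram a)) = \<bar>det (coords e a)\<bar>"
  using gram_eq_coords[OF assms] by (simp add: det_mul det_transpose)

lemma coords_frame:
  assumes "orthonormal_frame T e" shows "coords e e = mat 1"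
  using assms by (simp add: coords_def orthonormal_frame_def mat_def vec_eq_iff)

text \<open>
Matrix form of the chain rule in orthonormal coordinates.  It serves both to change the basis of a
tangent space and to multiply the Jacobians of two composed maps.
\<close>

lemma coords_linear_image:
  assumes e: "orthonormal_frame T e" and a: "range a \<subseteq> T" and L: "linear L"
  shows "coords e' (\<lambda>j. L (a j)) = coords e' (\<lambda>j. L (e j)) ** coords e a"
proof -
  have "e' i \<bullet> L (a j) = (\<Sum>k\<in>UNIV. (e' i \<bullet> L (e k)) * (e k \<bullet> a j))" for i j
  proof -
    have "L (a j) = L (\<Sum>k\<in>UNIV. (e k \<bullet> a j) *\<^sub>R e k)"
      using orthonormal_frame_expansion[OF e, of "a j"] a by (metis range_subsetD)
    also have "\<dots> = (\<Sum>k\<in>UNIV. (e k \<bullet> a j) *\<^sub>R L (e k))"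
      by (simp add: linear_sum[OF L] linear_cmul[OF L])
    finally show ?thesis by (simp add: inner_sum_right mult.commute)
  qed
  then show ?thesis by (simp add: coords_def vec_eq_iff matrix_matrix_mult_def)
qed

lemma det_coords_nonzero:
  fixes L :: "real^'d::finite \<Rightarrow> 'a::euclidean_space"
  assumes e: "orthonormal_frame T e" and L: "linear L" "inj L" and T: "range L \<subseteq> T"
  shows "det (coords e (\<lambda>j. L (axis j 1))) \<noteq> 0"
proof -
  let ?A = "coords e (\<lambda>j. L (axis j 1))"
  have mv: "(?A *v c) $ k = e k \<bullet> L c" for c k
  proof -
    have "L c = L (\<Sum>j\<in>UNIV. (c $ j) *\<^sub>R axis j 1)"
      by (metis (no_types) basis_expansion scalar_mult_eq_scaleR)
    also have "\<dots> = (\<Sum>j\<in>UNIV. (c $ j) *\<^sub>R L (axis j 1))"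
      by (simp add: linear_sum[OF L(1)] linear_cmul[OF L(1)])
    finally show ?thesis
      by (simp add: coords_def matrix_vector_mult_def inner_sum_right mult.commute)
  qed
  have "c = 0" if "?A *v c = 0" for c
  proof -
    have "e k \<bullet> L c = 0" for k using mv[of c k] that by simp
    then have "L c = 0" using orthonormal_frame_expansion[OF e, of "L c"] T by auto
    then show "c = 0" using L by (simp add: linear_injective_0)
  qed
  then have "inj ((*v) ?A)" using linear_injective_0[of "(*v) ?A"] by auto
  then show ?thesis
    using invertible_det_nz invertible_left_inverse matrix_left_invertible_injective by blast
qed

section \<open>Derivatives along curves in a set\<close>

text \<open>
The derivative within \<open>X\<close> is an arbitrary choice off the tangent vectors.  On the velocity
of a curve in \<open>X\<close> it is forced, because the image curve has only one velocity; every identity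
between derivatives on \<open>X\<close> below is obtained by comparing velocities.
\<close>

lemma curve_image:
  assumes f: "f differentiable (at x within X)" and "\<epsilon> > 0"
    and \<gamma>: "\<And>t::real. \<bar>t\<bar> < \<epsilon> \<Longrightarrow> \<gamma> t \<in> X" "\<gamma> 0 = x" "(\<gamma> has_vector_derivative v) (at 0)"
  shows "((\<lambda>t. f (\<gamma> t)) has_vector_derivative frechet_derivative f (at x within X) v) (at 0)"
proof -
  let ?I = "{-\<epsilon><..<\<epsilon>}"
  let ?D = "frechet_derivative f (at x within X)"
  have D: "(f has_derivative ?D) (at x within X)"
    using f frechet_derivative_works by blast
  have "(f has_derivative ?D) (at (\<gamma> 0) within \<gamma> ` ?I)"
    unfolding \<gamma>(2) using \<gamma>(1) by (intro has_derivative_subset[OF D]) (auto simp: abs_less_iff)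
  moreover have "(\<gamma> has_derivative (\<lambda>h. h *\<^sub>R v)) (at 0 within ?I)"
    using \<gamma>(3) has_derivative_at_withinI unfolding has_vector_derivative_def by blast
  ultimately have "((f \<circ> \<gamma>) has_derivative (?D \<circ> (\<lambda>h. h *\<^sub>R v))) (at 0 within ?I)"
    using diff_chain_within by blast
  moreover have "at 0 within ?I = at 0" using \<open>\<epsilon> > 0\<close> by (intro at_within_open) auto
  moreover have "?D \<circ> (\<lambda>h. h *\<^sub>R v) = (\<lambda>h. h *\<^sub>R ?D v)"
    using has_derivative_linear[OF D] by (auto simp: linear_cmul)
  ultimately show ?thesis unfolding has_vector_derivative_def comp_def by simp
qed

lemma tangent_image:
  assumes f: "f differentiable (at x within X)" "f ` X \<subseteq> Y" and v: "v \<in> tangent_space X x"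
  shows "frechet_derivative f (at x within X) v \<in> tangent_space Y (f x)"
proof -
  obtain \<gamma> \<epsilon> where g: "\<epsilon> > 0" "\<And>t::real. \<bar>t\<bar> < \<epsilon> \<Longrightarrow> \<gamma> t \<in> X" "\<gamma> 0 = x"
     "(\<gamma> has_vector_derivative v) (at 0)"
    using v unfolding tangent_space_def by blast
  show ?thesis unfolding tangent_space_def
    using curve_image[OF f(1) g] g f(2) by (intro CollectI exI[of _ "\<lambda>t. f (\<gamma> t)"] exI[of _ \<epsilon>]) auto
qed

lemma tangent_inverse:
  assumes f: "f differentiable (at x within X)" "f ` X \<subseteq> X"
    and h: "h differentiable (at (f x) within X)" and inv: "\<And>w. w \<in> X \<Longrightarrow> h (f w) = w"
    and v: "v \<in> tangent_space X x"
  shows "frechet_derivative h (at (f x) within X) (frechet_derivative f (at x within X) v) = v"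
proof -
  obtain \<gamma> \<epsilon> where g: "\<epsilon> > 0" "\<And>t::real. \<bar>t\<bar> < \<epsilon> \<Longrightarrow> \<gamma> t \<in> X" "\<gamma> 0 = x"
     "(\<gamma> has_vector_derivative v) (at 0)"
    using v unfolding tangent_space_def by blast
  let ?D = "frechet_derivative h (at (f x) within X) (frechet_derivative f (at x within X) v)"
  have "((\<lambda>t. h (f (\<gamma> t))) has_vector_derivative ?D) (at 0)"
    using curve_image[OF h g(1), of "\<lambda>t. f (\<gamma> t)"] curve_image[OF f(1) g] g f(2) by auto
  then have "(\<gamma> has_vector_derivative ?D) (at 0)"
    by (rule has_vector_derivative_transform_within_open[of _ _ _ "{-\<epsilon><..<\<epsilon>}"])
       (use g inv in \<open>auto simp: abs_less_iff\<close>)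
  then show ?thesis using g(4) vector_derivative_unique_at by blast
qed

section \<open>Local parametrizations\<close>

lemma local_parametrization_derivative:
  assumes "local_parametrization X U \<psi>" and "u \<in> U"
  shows "(\<psi> has_derivative frechet_derivative \<psi> (at u)) (at u)"
    and "linear (frechet_derivative \<psi> (at u))" and "inj (frechet_derivative \<psi> (at u))"
proof -
  have "C_k_on (Suc 0) \<psi> U" using assms unfolding local_parametrization_def smooth_on_def by blast
  then have "\<psi> differentiable (at u)" using assms by simp
  then show 1: "(\<psi> has_derivative frechet_derivative \<psi> (at u)) (at u)"
    using frechet_derivative_works by blast
  then show "linear (frechet_derivative \<psi> (at u))" by (rule has_derivative_linear)
  show "inj (frechet_derivative \<psi> (at u))" using assms unfolding local_parametrization_def by blast
qed

lemma local_parametrization_directional_continuous: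
  assumes "local_parametrization X U \<psi>"
  shows "continuous_on U (\<lambda>u. frechet_derivative \<psi> (at u) a)"
proof -
  have "C_k_on (Suc 0) \<psi> U" using assms unfolding local_parametrization_def smooth_on_def by blast
  then show ?thesis by simp
qed

lemma local_parametrization_derivative_continuous:
  assumes "local_parametrization X U \<psi>"
  shows "continuous_on (U \<times> UNIV) (\<lambda>(u, a). frechet_derivative \<psi> (at u) a)"
proof -
  note c = local_parametrization_directional_continuous[OF assms]
  have "continuous_on (U \<times> UNIV) (\<lambda>p. \<Sum>b\<in>Basis. (snd p \<bullet> b) *\<^sub>R frechet_derivative \<psi> (at (fst p)) b)"
    by (intro continuous_intros continuous_on_compose2[OF c]) auto
  moreover have "(\<Sum>b\<in>Basis. (a \<bullet> b) *\<^sub>R frechet_derivative \<psi> (at u) b) = frechet_derivative \<psi> (at u) a"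
    if "u \<in> U" for u a
  proof -
    have "frechet_derivative \<psi> (at u) a = frechet_derivative \<psi> (at u) (\<Sum>b\<in>Basis. (a \<bullet> b) *\<^sub>R b)"
      by (simp add: euclidean_representation)
    then show ?thesis using local_parametrization_derivative(2)[OF assms that]
      by (simp add: linear_sum linear_cmul)
  qed
  ultimately show ?thesis
    by (subst continuous_on_cong[OF refl, where g="\<lambda>p. \<Sum>b\<in>Basis. (snd p \<bullet> b) *\<^sub>R frechet_derivative \<psi> (at (fst p)) b"])
       auto
qed

text \<open>
By homogeneity it suffices to bound the maps on unit vectors, which form a compact set together
with the parameter.
\<close>

lemma linear_family_bounded_on_compact:
  fixes L :: "'b::euclidean_space \<Rightarrow> 'c::euclidean_space \<Rightarrow> 'd::euclidean_space"
  assumes K: "compact K" and c: "continuous_on (K \<times> UNIV) (\<lambda>(u, a). L u a)"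
    and lin: "\<And>u. u \<in> K \<Longrightarrow> linear (L u)"
  shows "\<exists>C>0. \<forall>u\<in>K. \<forall>a. norm (L u a) \<le> C * norm a"
proof -
  have "compact (K \<times> sphere (0::'c) 1)" using K by (intro compact_Times) auto
  then have "compact ((\<lambda>(u, a). L u a) ` (K \<times> sphere (0::'c) 1))"
    by (intro compact_continuous_image continuous_on_subset[OF c]) auto
  then obtain C where C: "C > 0" "\<And>u a. u \<in> K \<Longrightarrow> norm a = 1 \<Longrightarrow> norm (L u a) \<le> C"
    using compact_imp_bounded bounded_pos by (smt (verit) SigmaI case_prod_conv image_eqI mem_sphere_0)
  have "norm (L u a) \<le> C * norm a" if u: "u \<in> K" for u a
  proof (cases "a = 0")
    case True then show ?thesis using lin[OF u] by (simp add: linear_0)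
  next
    case False
    have "L u a = norm a *\<^sub>R L u (a /\<^sub>R norm a)" using False lin[OF u] by (simp add: linear_cmul)
    moreover have "norm (L u (a /\<^sub>R norm a)) \<le> C" using False by (intro C(2)[OF u]) simp
    ultimately show ?thesis by (metis abs_norm_cancel mult.commute mult_left_mono norm_ge_zero norm_scaleR)
  qed
  then show ?thesis using C(1) by blast
qed

lemma has_derivative_at_approx:
  assumes "(f has_derivative f') (at x)" and "e > 0"
  obtains d where "d > 0" and
    "\<And>y. norm (y - x) < d \<Longrightarrow> norm (f y - f x - f' (y - x)) \<le> e * norm (y - x)"
  using assms unfolding has_derivative_at_alt by blast

text \<open>
The derivative at \<open>u0\<close> is injective, hence bounded below, and nearby derivatives differ from it by
at most half of that bound.  The mean value inequality for \<open>\<psi>\<close> minus its linear part at \<open>u0\<close> then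
leaves half of the lower bound for \<open>\<psi>\<close> itself.  So the inverse of a parametrization is locally
Lipschitz, which replaces its differentiability in what follows.
\<close>

lemma local_parametrization_expanding:
  fixes \<psi> :: "real^'d::finite \<Rightarrow> 'a::euclidean_space"
  assumes lp: "local_parametrization X U \<psi>" and u0: "u0 \<in> U"
  shows "\<exists>\<rho>>0. \<exists>c>0. cball u0 \<rho> \<subseteq> U \<and>
    (\<forall>u\<in>cball u0 \<rho>. \<forall>u'\<in>cball u0 \<rho>. c * norm (u - u') \<le> norm (\<psi> u - \<psi> u'))"
proof -
  let ?D = "\<lambda>u. frechet_derivative \<psi> (at u)"
  have oU: "open U" using lp unfolding local_parametrization_def by blast
  obtain b where b: "b > 0" "\<And>a. b * norm a \<le> norm (?D u0 a)"
    using linear_inj_bounded_below_pos local_parametrization_derivative(2,3)[OF lp u0] by metis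
  define k where "k u = (\<Sum>i\<in>Basis. norm (?D u i - ?D u0 i))" for u
  have "continuous_on U k" unfolding k_def
    by (intro continuous_intros local_parametrization_directional_continuous[OF lp])
  then have "isCont k u0" using oU u0 continuous_on_eq_continuous_at by blast
  then have "\<forall>\<^sub>F u in nhds u0. k u < b / 2"
  proof (intro order_tendstoD[of _ "k u0"])
    show "(k \<longlongrightarrow> k u0) (nhds u0)"
      using \<open>isCont k u0\<close> by (simp add: isCont_def tendsto_nhds_iff)
    show "k u0 < b / 2" using b by (simp add: k_def)
  qed
  moreover have "\<forall>\<^sub>F u in nhds u0. u \<in> U" using oU u0 eventually_nhds by blast
  ultimately have "\<forall>\<^sub>F u in nhds u0. k u < b / 2 \<and> u \<in> U" by eventually_elim auto
  then obtain \<rho>0 where \<rho>0: "\<rho>0 > 0" "\<And>u. dist u u0 < \<rho>0 \<Longrightarrow> k u < b / 2 \<and> u \<in> U"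
    unfolding eventually_nhds_metric by blast
  define \<rho> where "\<rho> = \<rho>0 / 2"
  have \<rho>: "\<rho> > 0" "\<And>u. u \<in> cball u0 \<rho> \<Longrightarrow> k u < b / 2 \<and> u \<in> U"
    using \<rho>0 by (auto simp: \<rho>_def dist_commute)
  have bound: "norm (?D u a - ?D u0 a) \<le> b / 2 * norm a" if u: "u \<in> cball u0 \<rho>" for u a
  proof -
    have l: "linear (\<lambda>a. ?D u a - ?D u0 a)"
      using \<rho>(2)[OF u] u0 by (intro linear_compose_sub local_parametrization_derivative(2)[OF lp]) auto
    have "?D u a - ?D u0 a = (\<Sum>i\<in>Basis. (a \<bullet> i) *\<^sub>R (?D u i - ?D u0 i))"
      using linear_sum[OF l, of "\<lambda>i. (a \<bullet> i) *\<^sub>R i" Basis] linear_cmul[OF l]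
      by (simp add: euclidean_representation)
    also have "norm \<dots> \<le> (\<Sum>i\<in>Basis. norm a * norm (?D u i - ?D u0 i))"
      by (intro sum_norm_le) (simp add: Basis_le_norm mult_right_mono)
    also have "\<dots> = norm a * k u" by (simp add: k_def sum_distrib_left)
    also have "\<dots> \<le> norm a * (b / 2)" using \<rho>(2)[OF u] by (intro mult_left_mono) auto
    finally show ?thesis by (simp add: mult.commute)
  qed
  have "b / 2 * norm (u - u') \<le> norm (\<psi> u - \<psi> u')"
    if u: "u \<in> cball u0 \<rho>" "u' \<in> cball u0 \<rho>" for u u'
  proof -
    let ?h = "\<lambda>u. \<psi> u - ?D u0 u"
    have "norm (?h u - ?h u') \<le> b / 2 * norm (u - u')"
    proof (rule differentiable_bound[of "cball u0 \<rho>" _ "\<lambda>u a. ?D u a - ?D u0 a"])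
      fix w assume w: "w \<in> cball u0 \<rho>"
      show "(?h has_derivative (\<lambda>a. ?D w a - ?D u0 a)) (at w within cball u0 \<rho>)"
        using w \<rho>(2) u0 by (intro has_derivative_diff linear_imp_has_derivative
          has_derivative_at_withinI[OF local_parametrization_derivative(1)[OF lp]]
          local_parametrization_derivative(2)[OF lp]) auto
      show "onorm (\<lambda>a. ?D w a - ?D u0 a) \<le> b / 2" using bound[OF w] by (intro onorm_le)
    qed (use u in auto)
    moreover have "?h u - ?h u' = \<psi> u - \<psi> u' - ?D u0 (u - u')"
      using linear_diff[OF local_parametrization_derivative(2)[OF lp u0]] by simp
    ultimately have "norm (?D u0 (u - u')) \<le> norm (\<psi> u - \<psi> u') + b / 2 * norm (u - u')"
      using norm_triangle_sub[of "?D u0 (u - u')" "\<psi> u - \<psi> u'"] by (simp add: norm_minus_commute)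
    then show ?thesis using b(2)[of "u - u'"] by simp
  qed
  then show ?thesis using \<rho> b(1) by (intro exI[of _ \<rho>] conjI exI[of _ "b / 2"]) auto
qed

lemma local_parametrization_open_image:
  assumes lp: "local_parametrization X U \<psi>" and V: "open V" "V \<subseteq> U"
  shows "openin (top_of_set X) (\<psi> ` V)"
proof -
  obtain \<psi>' where "homeomorphism U (\<psi> ` U) \<psi> \<psi>'"
    using lp unfolding local_parametrization_def by blast
  moreover have "openin (top_of_set U) V" using V open_subset by blast
  ultimately have "openin (top_of_set (\<psi> ` U)) (\<psi> ` V)" by (rule homeomorphism_imp_open_map)
  moreover have "openin (top_of_set X) (\<psi> ` U)" using lp unfolding local_parametrization_def by blast
  ultimately show ?thesis using openin_trans by blast
qed

lemma local_parametrization_ball_subset: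
  assumes "local_parametrization X U \<psi>" and "open V" "V \<subseteq> U" and "u \<in> V"
  obtains r where "r > 0" and "X \<inter> ball (\<psi> u) r \<subseteq> \<psi> ` V"
  using local_parametrization_open_image[OF assms(1-3)] assms(4)
  unfolding openin_contains_ball by (metis image_eqI inf_commute)

lemma local_parametrization_subset:
  assumes "local_parametrization X U \<psi>" shows "\<psi> ` U \<subseteq> X"
  using assms openin_imp_subset unfolding local_parametrization_def by blast

text \<open>
A curve through \<open>\<psi> u\<close> is \<open>\<psi>\<close> of some curve of parameters, which moves at most linearly in time because
\<open>\<psi>\<close> expands.  So difference quotients of the curve are close to vectors in the range of the
derivative, and that range, a subspace, is closed.
\<close>

lemma tangent_space_parametrization:
  fixes \<psi> :: "real^'d::finite \<Rightarrow> 'a::euclidean_space"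
  assumes lp: "local_parametrization X U \<psi>" and u: "u \<in> U"
  shows "tangent_space X (\<psi> u) = range (frechet_derivative \<psi> (at u))"
proof
  let ?D = "frechet_derivative \<psi> (at u)"
  note D = local_parametrization_derivative[OF lp u]
  have oU: "open U" using lp unfolding local_parametrization_def by blast
  show "range ?D \<subseteq> tangent_space X (\<psi> u)"
  proof
    fix v assume "v \<in> range ?D"
    then obtain a where a: "v = ?D a" by blast
    let ?l = "\<lambda>t::real. u + t *\<^sub>R a"
    have "(?l \<longlongrightarrow> u + 0 *\<^sub>R a) (nhds 0)"
      by (intro tendsto_intros filterlim_ident)
    then have "\<forall>\<^sub>F t in nhds 0. ?l t \<in> U" using oU u by (intro topological_tendstoD) auto
    then obtain \<epsilon> where e: "\<epsilon> > 0" "\<And>t. \<bar>t\<bar> < \<epsilon> \<Longrightarrow> ?l t \<in> U"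
      unfolding eventually_nhds_metric by (auto simp: dist_norm)
    have "(?l has_derivative (\<lambda>t. t *\<^sub>R a)) (at 0)" by (auto intro!: derivative_eq_intros)
    then have "((\<psi> \<circ> ?l) has_derivative (?D \<circ> (\<lambda>t. t *\<^sub>R a))) (at 0)"
      by (rule diff_chain_at) (use D(1) in simp)
    then have "((\<lambda>t. \<psi> (?l t)) has_vector_derivative v) (at 0)"
      unfolding has_vector_derivative_def a comp_def using D(2) by (simp add: linear_cmul)
    then show "v \<in> tangent_space X (\<psi> u)" unfolding tangent_space_def
      using e local_parametrization_subset[OF lp]
      by (intro CollectI exI[of _ "\<lambda>t. \<psi> (?l t)"] exI[of _ \<epsilon>]) auto
  qed
  show "tangent_space X (\<psi> u) \<subseteq> range ?D"
  proof
    fix v assume "v \<in> tangent_space X (\<psi> u)"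
    then obtain \<gamma> \<epsilon> where g: "\<epsilon> > 0" "\<And>t::real. \<bar>t\<bar> < \<epsilon> \<Longrightarrow> \<gamma> t \<in> X" "\<gamma> 0 = \<psi> u"
       "(\<gamma> has_vector_derivative v) (at 0)"
      unfolding tangent_space_def by blast
    obtain \<rho> c where \<rho>: "\<rho> > 0" "c > 0" "cball u \<rho> \<subseteq> U"
      "\<And>w w'. w \<in> cball u \<rho> \<Longrightarrow> w' \<in> cball u \<rho> \<Longrightarrow> c * norm (w - w') \<le> norm (\<psi> w - \<psi> w')"
      using local_parametrization_expanding[OF lp u] by blast
    have appr: "\<exists>y\<in>range ?D. dist y v \<le> e * (1 + (norm v + 1) / c)" if e: "0 < e" "e \<le> 1" for e
    proof -
      obtain d where d: "d > 0"
        "\<And>w. norm (w - u) < d \<Longrightarrow> norm (\<psi> w - \<psi> u - ?D (w - u)) \<le> e * norm (w - u)"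
        using has_derivative_at_approx[OF D(1) e(1)] by blast
      have "open (ball u (min \<rho> d))" "ball u (min \<rho> d) \<subseteq> U" "u \<in> ball u (min \<rho> d)"
        using \<rho> d by auto
      then obtain r where r: "r > 0" "X \<inter> ball (\<psi> u) r \<subseteq> \<psi> ` ball u (min \<rho> d)"
        using local_parametrization_ball_subset[OF lp] by blast
      obtain s where s: "s > 0"
        "\<And>t. norm (t - 0) < s \<Longrightarrow> norm (\<gamma> t - \<gamma> 0 - (t - 0) *\<^sub>R v) \<le> e * norm (t - 0)"
        using has_derivative_at_approx[OF g(4)[unfolded has_vector_derivative_def] e(1)] by blast
      have "isCont \<gamma> 0" using g(4) has_vector_derivative_continuous by blast
      then have "\<forall>\<^sub>F t in at 0. dist (\<gamma> t) (\<gamma> 0) < r"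
        using r(1) by (simp add: isCont_def tendstoD)
      moreover have "\<forall>\<^sub>F t in at (0::real). \<bar>t\<bar> < min s \<epsilon>"
        unfolding eventually_at using s(1) g(1) by (intro exI[of _ "min s \<epsilon>"]) auto
      moreover have "\<forall>\<^sub>F t in at (0::real). t \<noteq> 0" by (simp add: eventually_at_filter)
      ultimately have "\<forall>\<^sub>F t in at 0. dist (\<gamma> t) (\<gamma> 0) < r \<and> \<bar>t\<bar> < min s \<epsilon> \<and> t \<noteq> 0"
        by eventually_elim auto
      then obtain t where t: "dist (\<gamma> t) (\<gamma> 0) < r" "\<bar>t\<bar> < s" "\<bar>t\<bar> < \<epsilon>" "t \<noteq> 0"
        using eventually_happens[of _ "at (0::real)"] by (auto simp: trivial_limit_at)
      then have "\<gamma> t \<in> X \<inter> ball (\<psi> u) r"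
        using g(2)[OF t(3)] g(3) by (auto simp: dist_norm norm_minus_commute)
      then obtain w where w: "\<gamma> t = \<psi> w" "norm (w - u) < \<rho>" "norm (w - u) < d"
        using r(2) by (auto simp: dist_norm norm_minus_commute)
      \<comment> \<open>The increment of the curve is within order \<open>e * t\<close> both of \<open>t *\<^sub>R v\<close> and of a vector in the range.\<close>
      have 1: "norm (\<gamma> t - \<gamma> 0 - t *\<^sub>R v) \<le> e * \<bar>t\<bar>" using s(2)[of t] t(2) by simp
      have 2: "c * norm (w - u) \<le> norm (\<gamma> t - \<gamma> 0)"
        using \<rho>(4)[of w u] w \<rho>(1) g(3) by (simp add: dist_norm norm_minus_commute)
      have "norm (\<gamma> t - \<gamma> 0) \<le> norm (t *\<^sub>R v) + e * \<bar>t\<bar>"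
        using 1 norm_triangle_sub[of "\<gamma> t - \<gamma> 0" "t *\<^sub>R v"] by linarith
      also have "\<dots> \<le> (norm v + 1) * \<bar>t\<bar>" using e by (simp add: algebra_simps mult_left_le_one_le)
      finally have "norm (w - u) \<le> (norm v + 1) / c * \<bar>t\<bar>" using 2 \<rho>(2) by (simp add: field_simps)
      then have 3: "norm (\<gamma> t - \<gamma> 0 - ?D (w - u)) \<le> e * ((norm v + 1) / c * \<bar>t\<bar>)"
        using order_trans[OF d(2)[OF w(3)] mult_left_mono[OF _ less_imp_le[OF e(1)]]]
        unfolding g(3) w(1) by blast
      have "norm (?D (w - u) - t *\<^sub>R v) \<le> e * ((norm v + 1) / c * \<bar>t\<bar>) + e * \<bar>t\<bar>"
        using norm_triangle_ineq4[of "\<gamma> t - \<gamma> 0 - t *\<^sub>R v" "\<gamma> t - \<gamma> 0 - ?D (w - u)"] 1 3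
        by (simp add: norm_minus_commute)
      also have "\<dots> = (e * (1 + (norm v + 1) / c)) * \<bar>t\<bar>" by (simp add: algebra_simps)
      finally have 4: "norm (?D (w - u) - t *\<^sub>R v) \<le> (e * (1 + (norm v + 1) / c)) * \<bar>t\<bar>" .
      have "dist (?D ((w - u) /\<^sub>R t)) v = norm ((?D (w - u) - t *\<^sub>R v) /\<^sub>R t)"
        unfolding linear_cmul[OF D(2)] dist_norm using t(4) by (simp add: scaleR_diff_right)
      also have "\<dots> = norm (?D (w - u) - t *\<^sub>R v) / \<bar>t\<bar>" by (simp add: divide_inverse mult.commute)
      also have "\<dots> \<le> e * (1 + (norm v + 1) / c)" using 4 t(4) by (simp add: pos_divide_le_eq)
      finally show ?thesis by blast
    qed
    have "v \<in> closure (range ?D)"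
      unfolding closure_approachable
    proof (intro allI impI)
      fix e :: real assume e: "0 < e"
      let ?C = "1 + (norm v + 1) / c"
      have C: "?C > 0" using \<rho>(2) by (smt (verit) divide_nonneg_pos norm_ge_zero)
      define e' where "e' = min 1 (e / (2 * ?C))"
      have "0 < e / (2 * ?C)" using e C by (intro divide_pos_pos mult_pos_pos) auto
      then have "0 < e'" "e' \<le> 1" unfolding e'_def by auto
      moreover have "e' * ?C \<le> e / (2 * ?C) * ?C"
        unfolding e'_def using C by (intro mult_right_mono min.cobounded2) simp
      moreover have "e / (2 * ?C) * ?C = e / 2"
        using C by (metis nonzero_mult_divide_mult_cancel_right2 less_irrefl mult.commute times_divide_eq_left)
      ultimately have "0 < e'" "e' \<le> 1" "e' * ?C < e" using e by linarith+
      then show "\<exists>y\<in>range ?D. dist y v < e" using appr[of e'] order_le_less_trans by blast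
    qed
    moreover have "closed (range ?D)"
      using D(2) by (intro closed_subspace linear_subspace_image) auto
    ultimately show "v \<in> range ?D" by simp
  qed
qed

lemma tangent_frame_orthonormal:
  fixes X :: "'a::euclidean_space set"
  assumes X: "compact_smooth_manifold TYPE('d::finite) X" and x: "x \<in> X"
  shows "orthonormal_frame (tangent_space X x) (tangent_frame X x :: 'd \<Rightarrow> 'a)"
proof -
  obtain U :: "(real^'d) set" and \<psi> u where lp: "local_parametrization X U \<psi>" and u: "u \<in> U" "x = \<psi> u"
    using X x unfolding compact_smooth_manifold_def by blast
  note D = local_parametrization_derivative[OF lp u(1)]
  have "subspace (tangent_space X x)" "dim (tangent_space X x) = CARD('d)"
    unfolding u(2) tangent_space_parametrization[OF lp u(1)]
    using D(2,3) dim_image_eq[of _ "UNIV :: (real^'d) set"]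
    by (auto intro: linear_subspace_image simp: inj_on_subset)
  then show ?thesis unfolding tangent_frame_def using orthonormal_frame_exists someI_ex by metis
qed

lemma continuous_on_det_gram:
  assumes "\<And>i. continuous_on S (\<lambda>x. a x i)"
  shows "continuous_on S (\<lambda>x. det (gram (a x)))"
  unfolding det_def gram_def using assms by (simp, intro continuous_intros) auto

lemma volume_density_gram:
  "volume_density \<psi> u = sqrt (det (gram (\<lambda>i. frechet_derivative \<psi> (at u) (axis i 1))))"
  by (simp add: volume_density_def gram_def)

lemma volume_density_pos:
  fixes \<psi> :: "real^'d::finite \<Rightarrow> 'a::euclidean_space"
  assumes lp: "local_parametrization X U \<psi>" and u: "u \<in> U"
  shows "volume_density \<psi> u > 0"
proof -
  note D = local_parametrization_derivative[OF lp u]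
  let ?T = "range (frechet_derivative \<psi> (at u))"
  have "subspace ?T" "dim ?T = CARD('d)"
    using D(2,3) dim_image_eq[of _ "UNIV :: (real^'d) set"]
    by (auto intro: linear_subspace_image simp: inj_on_subset)
  then obtain e :: "'d \<Rightarrow> 'a" where e: "orthonormal_frame ?T e" using orthonormal_frame_exists by blast
  have "volume_density \<psi> u = \<bar>det (coords e (\<lambda>i. frechet_derivative \<psi> (at u) (axis i 1)))\<bar>"
    unfolding volume_density_gram by (rule det_gram[OF e]) auto
  then show ?thesis using det_coords_nonzero[OF e D(2,3)] by simp
qed

lemma volume_density_continuous:
  assumes lp: "local_parametrization X U \<psi>"
  shows "continuous_on U (volume_density \<psi>)"
proof -
  show ?thesis unfolding volume_density_gram[abs_def]
    by (intro continuous_intros continuous_on_det_gram local_parametrization_directional_continuous[OF lp])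
qed

section \<open>Jacobian determinants on a manifold\<close>

lemma abs_det_deriv_coords:
  "abs_det_deriv TYPE('d::finite) X f x =
     \<bar>det (coords (tangent_frame X (f x) :: 'd \<Rightarrow> 'a::euclidean_space)
        (\<lambda>j. frechet_derivative f (at x within X) (tangent_frame X x j)))\<bar>"
  by (simp add: abs_det_deriv_def coords_def)

lemma frechet_derivative_linear:
  "f differentiable F \<Longrightarrow> linear (frechet_derivative f F)"
  using frechet_derivative_works has_derivative_linear by blast

text \<open>
The flow is only assumed to be jointly regular forwards from a fixed state of the driving system;
the Jacobian of the backward maps is reached through this reciprocal.
\<close>

lemma abs_det_deriv_inverse:
  fixes X :: "'a::euclidean_space set"
  assumes X: "compact_smooth_manifold TYPE('d::finite) X" and x: "x \<in> X"
    and f: "f differentiable (at x within X)" "f ` X \<subseteq> X"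
    and h: "h differentiable (at (f x) within X)" and inv: "\<And>w. w \<in> X \<Longrightarrow> h (f w) = w"
  shows "abs_det_deriv TYPE('d) X h (f x) * abs_det_deriv TYPE('d) X f x = 1"
proof -
  let ?Df = "frechet_derivative f (at x within X)" and ?Dh = "frechet_derivative h (at (f x) within X)"
  let ?e = "tangent_frame X x :: 'd \<Rightarrow> 'a" and ?e' = "tangent_frame X (f x) :: 'd \<Rightarrow> 'a"
  have e: "orthonormal_frame (tangent_space X x) ?e"
    and e': "orthonormal_frame (tangent_space X (f x)) ?e'"
    using tangent_frame_orthonormal[OF X] x f(2) by auto
  have "mat 1 = coords ?e (\<lambda>j. ?Dh (?Df (?e j)))"
    using tangent_inverse[OF f h inv orthonormal_frame_in[OF e]] coords_frame[OF e] by simp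
  also have "\<dots> = coords ?e (\<lambda>j. ?Dh (?e' j)) ** coords ?e' (\<lambda>j. ?Df (?e j))"
    using tangent_image[OF f orthonormal_frame_in[OF e]]
    by (intro coords_linear_image[OF e'] frechet_derivative_linear h) auto
  finally have "det (coords ?e (\<lambda>j. ?Dh (?e' j))) * det (coords ?e' (\<lambda>j. ?Df (?e j))) = 1"
    by (metis det_I det_mul)
  then show ?thesis unfolding abs_det_deriv_coords by (simp add: inv[OF x] flip: abs_mult)
qed

text \<open>
The Jacobian as the factor by which volume density changes, with no reference to frames.
\<close>

lemma abs_det_deriv_parametrization:
  fixes X :: "'a::euclidean_space set" and \<psi> :: "real^'d::finite \<Rightarrow> 'a"
  assumes X: "compact_smooth_manifold TYPE('d) X"
    and lp: "local_parametrization X U \<psi>" and u: "u \<in> U"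
    and f: "f differentiable (at (\<psi> u) within X)" "f ` X \<subseteq> X"
  shows "abs_det_deriv TYPE('d) X f (\<psi> u) =
    sqrt (det (gram (\<lambda>j. frechet_derivative f (at (\<psi> u) within X)
      (frechet_derivative \<psi> (at u) (axis j 1))))) / volume_density \<psi> u"
proof -
  let ?Df = "frechet_derivative f (at (\<psi> u) within X)" and ?a = "\<lambda>j. frechet_derivative \<psi> (at u) (axis j 1)"
  let ?e = "tangent_frame X (\<psi> u) :: 'd \<Rightarrow> 'a" and ?e' = "tangent_frame X (f (\<psi> u)) :: 'd \<Rightarrow> 'a"
  have x: "\<psi> u \<in> X" using local_parametrization_subset[OF lp] u by blast
  have e: "orthonormal_frame (tangent_space X (\<psi> u)) ?e"
    and e': "orthonormal_frame (tangent_space X (f (\<psi> u))) ?e'"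
    using tangent_frame_orthonormal[OF X] x f(2) by auto
  have a: "range ?a \<subseteq> tangent_space X (\<psi> u)" using tangent_space_parametrization[OF lp u] by auto
  have "sqrt (det (gram (\<lambda>j. ?Df (?a j)))) = \<bar>det (coords ?e' (\<lambda>j. ?Df (?a j)))\<bar>"
    using tangent_image[OF f] a by (intro det_gram[OF e']) auto
  also have "\<dots> = \<bar>det (coords ?e' (\<lambda>j. ?Df (?e j)))\<bar> * \<bar>det (coords ?e ?a)\<bar>"
    unfolding coords_linear_image[OF e a frechet_derivative_linear[OF f(1)]]
    by (simp add: det_mul abs_mult)
  also have "\<bar>det (coords ?e ?a)\<bar> = volume_density \<psi> u"
    unfolding volume_density_gram by (rule det_gram[OF e a, symmetric])
  finally show ?thesis
    using volume_density_pos[OF lp u] unfolding abs_det_deriv_coords by (simp add: field_simps)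
qed

text \<open>
In a parametrization the vectors \<open>D\<psi> axis\<close> form a basis of the tangent space that depends continuously
on the point, and the frame-free formula expresses the Jacobian in them.
\<close>

lemma abs_det_deriv_continuous:
  fixes X :: "'a::euclidean_space set" and f :: "'t::t2_space \<Rightarrow> 'a \<Rightarrow> 'a"
  assumes X: "compact_smooth_manifold TYPE('d::finite) X"
    and f: "\<And>t x. t \<in> T \<Longrightarrow> x \<in> X \<Longrightarrow> f t differentiable (at x within X)"
      "\<And>t. t \<in> T \<Longrightarrow> f t ` X \<subseteq> X"
    and Df: "continuous_on (T \<times> tangent_bundle X) (\<lambda>(t, x, v). frechet_derivative (f t) (at x within X) v)"
  shows "continuous_on (T \<times> X) (\<lambda>(t, x). abs_det_deriv TYPE('d) X (f t) x)"
proof -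
  have "continuous (at (t0, x0) within T \<times> X) (\<lambda>(t, x). abs_det_deriv TYPE('d) X (f t) x)"
    if tx: "t0 \<in> T" "x0 \<in> X" for t0 x0
  proof -
    obtain U :: "(real^'d) set" and \<psi> where lp: "local_parametrization X U \<psi>" and x0: "x0 \<in> \<psi> ` U"
      using X tx(2) unfolding compact_smooth_manifold_def by blast
    obtain \<psi>' where hom: "homeomorphism U (\<psi> ` U) \<psi> \<psi>'"
      using lp unfolding local_parametrization_def by blast
    obtain O' where O': "open O'" "\<psi> ` U = X \<inter> O'"
      using lp unfolding local_parametrization_def openin_open by blast
    let ?S = "T \<times> \<psi> ` U"
    let ?D = "\<lambda>j p. frechet_derivative \<psi> (at (\<psi>' (snd p))) (axis j 1)"
    have inv: "\<psi> (\<psi>' x) = x" "\<psi>' x \<in> U" if "x \<in> \<psi> ` U" for x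
      using hom that unfolding homeomorphism_def by auto
    have c': "continuous_on ?S (\<lambda>p. \<psi>' (snd p))"
    proof (rule continuous_on_compose2[where g = \<psi>'])
      show "continuous_on (\<psi> ` U) \<psi>'" using hom unfolding homeomorphism_def by blast
    qed (auto intro: continuous_intros)
    have cD: "continuous_on ?S (?D j)" for j
      using inv by (intro continuous_on_compose2[OF local_parametrization_directional_continuous[OF lp] c']) auto
    have "continuous_on ?S (\<lambda>p. (\<lambda>(t, x, v). frechet_derivative (f t) (at x within X) v) (fst p, snd p, ?D j p))" for j
    proof (rule continuous_on_compose2[OF Df])
      show "continuous_on ?S (\<lambda>p. (fst p, snd p, ?D j p))" by (intro continuous_intros cD)
      have "?D j (t, x) \<in> tangent_space X x" if "x \<in> \<psi> ` U" for t x
        using tangent_space_parametrization[OF lp inv(2)[OF that]] inv(1)[OF that] by auto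
      then show "(\<lambda>p. (fst p, snd p, ?D j p)) ` ?S \<subseteq> T \<times> tangent_bundle X"
        using O'(2) unfolding tangent_bundle_def by force
    qed
    then have "continuous_on ?S (\<lambda>p. sqrt (det (gram (\<lambda>j. frechet_derivative (f (fst p)) (at (snd p) within X) (?D j p))))
        / volume_density \<psi> (\<psi>' (snd p)))"
      using inv volume_density_pos[OF lp]
      by (intro continuous_intros continuous_on_det_gram
          continuous_on_compose2[OF volume_density_continuous[OF lp] c']) (auto simp: less_imp_neq[symmetric])
    then have "continuous_on ?S (\<lambda>(t, x). abs_det_deriv TYPE('d) X (f t) x)"
    proof (rule continuous_on_eq)
      fix p assume "p \<in> ?S"
      then obtain t x where p: "p = (t, x)" "t \<in> T" "x \<in> \<psi> ` U" by auto
      then have "x \<in> X" using O'(2) by auto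
      then show "sqrt (det (gram (\<lambda>j. frechet_derivative (f (fst p)) (at (snd p) within X) (?D j p))))
          / volume_density \<psi> (\<psi>' (snd p)) = (case p of (t, x) \<Rightarrow> abs_det_deriv TYPE('d) X (f t) x)"
        using abs_det_deriv_parametrization[OF X lp inv(2)[OF p(3)], of "f t"] f[OF p(2)] inv(1)[OF p(3)] p(1)
        by simp
    qed
    then have "continuous (at (t0, x0) within ?S) (\<lambda>(t, x). abs_det_deriv TYPE('d) X (f t) x)"
      unfolding continuous_on_eq_continuous_within using tx(1) x0 by blast
    moreover have "at (t0, x0) within ?S = at (t0, x0) within (T \<times> X)"
      by (rule at_within_nhd[of _ "UNIV \<times> O'"]) (use O' x0 in \<open>auto intro: open_Times\<close>)
    ultimately show ?thesis by simp
  qed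
  then show ?thesis by (auto simp: continuous_on_eq_continuous_within)
qed

text \<open>
The map \<open>(t, x) \<mapsto> (t, f t x)\<close> is a continuous bijection of a compact space, hence a homeomorphism.
\<close>

lemma continuous_on_inverse_family:
  fixes f :: "'t::t2_space \<Rightarrow> 'a::t2_space \<Rightarrow> 'a"
  assumes "compact T" "compact X" and f: "continuous_on (T \<times> X) (\<lambda>(t, x). f t x)"
    and maps: "\<And>t x. t \<in> T \<Longrightarrow> x \<in> X \<Longrightarrow> g t x \<in> X \<and> f t (g t x) = x"
      "\<And>t x. t \<in> T \<Longrightarrow> x \<in> X \<Longrightarrow> f t x \<in> X \<and> g t (f t x) = x"
  shows "continuous_on (T \<times> X) (\<lambda>(t, x). g t x)"
proof -
  let ?F = "\<lambda>p. (fst p, f (fst p) (snd p))" and ?G = "\<lambda>p. (fst p, g (fst p) (snd p))"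
  have "?F ` (T \<times> X) = T \<times> X"
  proof
    show "T \<times> X \<subseteq> ?F ` (T \<times> X)"
    proof
      fix p assume "p \<in> T \<times> X"
      then have "p = ?F (?G p)" "?G p \<in> T \<times> X" using maps(1) by auto
      then show "p \<in> ?F ` (T \<times> X)" by blast
    qed
  qed (use maps in auto)
  moreover have "continuous_on (?F ` (T \<times> X)) ?G"
    using f maps assms(1,2) by (intro continuous_on_inv compact_Times) (auto intro!: continuous_intros simp: case_prod_beta')
  ultimately have "continuous_on (T \<times> X) ?G" by simp
  from continuous_on_snd[OF this] show ?thesis by (simp add: case_prod_beta')
qed

section \<open>Lipschitz maps and Lebesgue measure\<close>

text \<open>
Cover \<open>S\<close> by countably many almost disjoint dyadic cubes of total volume close to that of \<open>S\<close>.  Within a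
cube of side \<open>s\<close> two points are at distance at most \<open>DIM('a) * s\<close>, so its image lies in a cube with half
side \<open>L * DIM('a) * s\<close>.
\<close>

lemma measure_lipschitz_image_le:
  fixes f :: "'a::euclidean_space \<Rightarrow> 'a"
  assumes S: "S \<in> lmeasurable" "bounded S" and fS: "f ` S \<in> sets lebesgue" and L: "L \<ge> 0"
    and lip: "\<And>x y. x \<in> S \<Longrightarrow> y \<in> S \<Longrightarrow> norm (f x - f y) \<le> L * norm (x - y)"
  shows "f ` S \<in> lmeasurable"
    and "measure lebesgue (f ` S) \<le> (2 * L * DIM('a)) ^ DIM('a) * measure lebesgue S"
proof -
  let ?M = "measure lebesgue" and ?C = "(2 * L * DIM('a)) ^ DIM('a)"
  have main: "f ` S \<in> lmeasurable \<and> ?M (f ` S) \<le> ?C * (?M S + e)" if e: "e > 0" for e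
  proof -
    obtain B where B: "B > 0" "\<And>x. x \<in> S \<Longrightarrow> norm x \<le> B" using S(2) bounded_pos by blast
    let ?b = "B *\<^sub>R One :: 'a"
    have "\<bar>x \<bullet> i\<bar> \<le> B" if "x \<in> S" "i \<in> Basis" for x i
      using Basis_le_norm[OF that(2)] B(2)[OF that(1)] order_trans by blast
    then have "S \<subseteq> cbox (- ?b) ?b" by (fastforce simp: mem_box abs_le_iff)
    then obtain \<D> where \<D>: "countable \<D>"
      "\<And>K. K \<in> \<D> \<Longrightarrow> K \<subseteq> cbox (- ?b) ?b \<and> K \<noteq> {} \<and> (\<exists>c d. K = cbox c d)"
      "pairwise (\<lambda>A B. interior A \<inter> interior B = {}) \<D>"
      "\<And>u v. cbox u v \<in> \<D> \<Longrightarrow> \<exists>n. \<forall>i \<in> Basis. v \<bullet> i - u \<bullet> i = (?b \<bullet> i - (- ?b) \<bullet> i)/2^n"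
      "S \<subseteq> \<Union>\<D>" "\<Union>\<D> \<in> lmeasurable" "?M (\<Union>\<D>) \<le> ?M S + e"
      using measurable_outer_intervals_bounded[OF S(1) _ e] by metis
    have box: "\<exists>J. J \<in> lmeasurable \<and> f ` (S \<inter> K) \<subseteq> J \<and> ?M J \<le> ?C * ?M K" if K: "K \<in> \<D>" for K
    proof (cases "S \<inter> K = {}")
      case True
      then show ?thesis using L by (intro exI[of _ "{}"]) auto
    next
      case False
      then obtain x0 where x0: "x0 \<in> S" "x0 \<in> K" by blast
      obtain u v where uv: "K = cbox u v" "cbox u v \<noteq> {}" using \<D>(2)[OF K] by blast
      obtain n where n: "\<And>i. i \<in> Basis \<Longrightarrow> v \<bullet> i - u \<bullet> i = (?b \<bullet> i - (- ?b) \<bullet> i)/2^n"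
        using \<D>(4)[of u v] K uv by blast
      define s where "s = 2 * B / 2 ^ n"
      have s: "v \<bullet> i - u \<bullet> i = s" if "i \<in> Basis" for i
        using n[OF that] that by (simp add: s_def)
      have s0: "s \<ge> 0" using B(1) by (simp add: s_def)
      have MK: "?M K = s ^ DIM('a)"
        using uv(2) s unfolding uv(1) by (simp add: content_cbox')
      define R where "R = L * (DIM('a) * s)"
      let ?J = "cbox (f x0 - R *\<^sub>R One) (f x0 + R *\<^sub>R One)"
      have R0: "R \<ge> 0" using L s0 by (simp add: R_def)
      have "f x \<in> ?J" if x: "x \<in> S" "x \<in> K" for x
      proof -
        have "\<bar>(x - x0) \<bullet> i\<bar> \<le> s" if i: "i \<in> Basis" for i
        proof -
          have "u \<bullet> i \<le> x \<bullet> i" "x \<bullet> i \<le> v \<bullet> i" "u \<bullet> i \<le> x0 \<bullet> i" "x0 \<bullet> i \<le> v \<bullet> i"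
            using x(2) x0(2) i unfolding uv(1) by (auto simp: mem_box)
          then show ?thesis using s[OF i] unfolding inner_diff_left abs_le_iff by linarith
        qed
        then have "norm (x - x0) \<le> (\<Sum>i\<in>(Basis::'a set). s)"
          by (intro order_trans[OF norm_le_l1 sum_mono]) auto
        then have "norm (f x - f x0) \<le> R"
          using order_trans[OF lip[OF x(1) x0(1)] mult_left_mono[OF _ L]] by (simp add: R_def)
        then have "\<bar>(f x - f x0) \<bullet> i\<bar> \<le> R" if "i \<in> Basis" for i
          using Basis_le_norm[OF that] order_trans by blast
        then show ?thesis by (force simp: mem_box inner_diff_left inner_add_left abs_le_iff)
      qed
      then have "f ` (S \<inter> K) \<subseteq> ?J" by auto
      moreover have "?M ?J = (2 * R) ^ DIM('a)"
      proof -
        have "?J \<noteq> {}" using R0 by (simp add: box_ne_empty inner_diff_left inner_add_left)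
        then show ?thesis by (simp add: content_cbox' inner_diff_left inner_add_left)
      qed
      moreover have "(2 * R) ^ DIM('a) = ?C * ?M K"
        unfolding R_def MK by (simp add: power_mult_distrib)
      ultimately show ?thesis by (intro exI[of _ ?J]) auto
    qed
    then obtain J where J: "\<And>K. K \<in> \<D> \<Longrightarrow> J K \<in> lmeasurable"
        "\<And>K. K \<in> \<D> \<Longrightarrow> f ` (S \<inter> K) \<subseteq> J K" "\<And>K. K \<in> \<D> \<Longrightarrow> ?M (J K) \<le> ?C * ?M K"
      by metis
    have fin: "?M (\<Union>K\<in>\<E>. J K) \<le> ?C * (?M S + e)" if E: "\<E> \<subseteq> \<D>" "finite \<E>" for \<E>
    proof -
      have KE: "K \<in> lmeasurable" if "K \<in> \<E>" for K using \<D>(2) E that by blast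
      have neg: "pairwise (\<lambda>S T. negligible (S \<inter> T)) \<E>"
      proof (rule pairwiseI)
        fix K K' assume K: "K \<in> \<E>" "K' \<in> \<E>" "K \<noteq> K'"
        obtain a b c d where 1: "K = cbox a b" "K' = cbox c d" using \<D>(2) E K by (metis subsetD)
        have "interior (K \<inter> K') = {}" using \<D>(3) E K by (auto simp: pairwise_def)
        moreover have "convex (K \<inter> K')" unfolding 1 by (intro convex_Int convex_box)
        ultimately show "negligible (K \<inter> K')"
          using negligible_convex_interior by blast
      qed
      have "?M (\<Union>K\<in>\<E>. J K) \<le> (\<Sum>K\<in>\<E>. ?M (J K))"
        using E J(1) by (intro measure_UNION_le) (auto dest: subsetD)
      also have "\<dots> \<le> (\<Sum>K\<in>\<E>. ?C * ?M K)" using E J(3) by (intro sum_mono) auto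
      also have "\<dots> = ?C * ?M (\<Union>\<E>)"
        using measure_negligible_finite_Union[OF E(2) KE neg] by (simp add: sum_distrib_left)
      also have "\<dots> \<le> ?C * (?M S + e)"
      proof (intro mult_left_mono order_trans[OF _ \<D>(7)])
        show "?M (\<Union>\<E>) \<le> ?M (\<Union>\<D>)"
          using E KE \<D>(6) by (intro measure_mono_fmeasurable) (auto intro!: fmeasurableD fmeasurable.finite_Union)
      qed (use L in auto)
      finally show ?thesis .
    qed
    have 1: "(\<Union>K\<in>\<D>. J K) \<in> lmeasurable" "?M (\<Union>K\<in>\<D>. J K) \<le> ?C * (?M S + e)"
      using fmeasurable_UN_bound[OF \<D>(1) J(1) fin] measure_UN_bound[OF \<D>(1) J(1) fin] by auto
    have 2: "f ` S \<subseteq> (\<Union>K\<in>\<D>. J K)" using \<D>(5) J(2) by fastforce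
    have "f ` S \<in> lmeasurable" using 1(1) 2 fS fmeasurableI2 by blast
    then show ?thesis using measure_mono_fmeasurable[OF 2 fS 1(1)] 1(2) by simp
  qed
  then show "f ` S \<in> lmeasurable" using zero_less_one by blast
  show "?M (f ` S) \<le> ?C * ?M S"
  proof (rule field_le_epsilon)
    fix e :: real assume e: "e > 0"
    have C: "?C \<ge> 0" using L by simp
    have "?C * (e / (?C + 1)) = e * (?C / (?C + 1))" by simp
    also have "\<dots> \<le> e * 1" using e C by (intro mult_left_mono) (auto simp: divide_le_eq_1)
    finally have "?C * (?M S + e / (?C + 1)) \<le> ?C * ?M S + e" by (simp add: distrib_left)
    moreover have "e / (?C + 1) > 0" using e C by (intro divide_pos_pos) auto
    ultimately show "?M (f ` S) \<le> ?C * ?M S + e" using main[of "e / (?C + 1)"] by linarith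
  qed
qed

section \<open>Volume under a compact family of differentiable maps\<close>

lemma sets_volume_measure_iff:
  assumes "volume_measure TYPE('d::finite) X \<nu>" and "compact X"
  shows "A \<in> sets \<nu> \<longleftrightarrow> A \<in> sets borel \<and> A \<subseteq> X"
proof -
  have "X \<in> sets borel" using assms(2) by (simp add: compact_imp_closed)
  then show ?thesis using assms(1) unfolding volume_measure_def
    by (simp add: sets_restrict_space_iff conj_commute)
qed

lemma borel_continuous_preimage:
  fixes f :: "'a::topological_space \<Rightarrow> 'b::topological_space"
  assumes "S \<in> sets borel" and "continuous_on S f" and "A \<in> sets borel"
  shows "S \<inter> f -` A \<in> sets borel"
proof -
  have "f -` A \<inter> space (restrict_space borel S) \<in> sets (restrict_space borel S)"
    using assms(3) by (intro measurable_sets[OF borel_measurable_continuous_on_restrict[OF assms(2)]]) auto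
  then show ?thesis using assms(1) by (simp add: sets_restrict_space_iff space_restrict_space Int_commute)
qed

text \<open>
Read in parametrizations around \<open>x0\<close> and \<open>f t0 x0\<close>, the maps \<open>f t\<close> become maps \<open>\<theta>\<close> between subsets of
\<open>real^'d\<close> that are Lipschitz with one constant for all \<open>t\<close> near \<open>t0\<close>: the derivative of \<open>f t \<circ> \<psi>\<close> is
bounded on a compact set of parameters, and the inverse of \<open>\<eta>\<close> is Lipschitz.  The image bound for
Lebesgue measure carries over because the volume densities of \<open>\<psi>\<close> and \<open>\<eta>\<close> are bounded away from
zero and infinity on compact sets.
\<close>

lemma volume_local_image_bound:
  fixes X :: "'a::euclidean_space set" and f :: "real \<Rightarrow> 'a \<Rightarrow> 'a"
  assumes X: "compact_smooth_manifold TYPE('d::finite) X" and \<nu>: "volume_measure TYPE('d) X \<nu>"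
    and T: "compact T"
    and f: "\<And>t x. t \<in> T \<Longrightarrow> x \<in> X \<Longrightarrow> f t differentiable (at x within X)"
      "\<And>t. t \<in> T \<Longrightarrow> f t ` X \<subseteq> X"
    and cf: "continuous_on (T \<times> X) (\<lambda>(t, x). f t x)"
    and Df: "continuous_on (T \<times> tangent_bundle X) (\<lambda>(t, x, v). frechet_derivative (f t) (at x within X) v)"
    and fA: "\<And>t A. t \<in> T \<Longrightarrow> A \<in> sets \<nu> \<Longrightarrow> f t ` A \<in> sets \<nu>"
    and tx: "t0 \<in> T" "x0 \<in> X"
  shows "\<exists>\<delta>>0. \<exists>C\<ge>0. \<forall>t\<in>T \<inter> ball t0 \<delta>. \<forall>A\<in>sets \<nu>. A \<subseteq> ball x0 \<delta> \<longrightarrow>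
    emeasure \<nu> (f t ` A) \<le> ennreal C * emeasure \<nu> A"
proof -
  have cX: "compact X" using X unfolding compact_smooth_manifold_def by blast
  note sets_nu = sets_volume_measure_iff[OF \<nu> cX]
  obtain U :: "(real^'d) set" and \<psi> u0 where lp: "local_parametrization X U \<psi>" and u0: "u0 \<in> U" "x0 = \<psi> u0"
    using X tx(2) unfolding compact_smooth_manifold_def by blast
  have "f t0 x0 \<in> X" using f(2) tx by blast
  then obtain V :: "(real^'d) set" and \<eta> v0 where lp': "local_parametrization X V \<eta>" and v0: "v0 \<in> V" "f t0 x0 = \<eta> v0"
    using X unfolding compact_smooth_manifold_def by blast
  obtain \<sigma> c where \<sigma>: "\<sigma> > 0" "c > 0" "cball v0 \<sigma> \<subseteq> V"
    "\<And>w w'. w \<in> cball v0 \<sigma> \<Longrightarrow> w' \<in> cball v0 \<sigma> \<Longrightarrow> c * norm (w - w') \<le> norm (\<eta> w - \<eta> w')"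
    using local_parametrization_expanding[OF lp' v0(1)] by blast
  have "ball v0 \<sigma> \<subseteq> V" using \<sigma>(3) ball_subset_cball by blast
  then obtain r where r: "r > 0" "X \<inter> ball (\<eta> v0) r \<subseteq> \<eta> ` ball v0 \<sigma>"
    using local_parametrization_ball_subset[OF lp' open_ball, of v0 \<sigma> v0] \<sigma>(1) by auto
  have "\<forall>e>0. \<exists>d>0. \<forall>p\<in>T \<times> X. dist p (t0, x0) < d \<longrightarrow> dist (f (fst p) (snd p)) (f t0 x0) < e"
    using cf tx unfolding continuous_on_iff by (fastforce simp: case_prod_beta')
  then obtain d where d: "d > 0"
    "\<And>t x. t \<in> T \<Longrightarrow> x \<in> X \<Longrightarrow> dist (t, x) (t0, x0) < d \<Longrightarrow> dist (f t x) (f t0 x0) < r"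
    using r(1) by (metis SigmaI fst_conv snd_conv)
  have d2: "f t x \<in> \<eta> ` ball v0 \<sigma>" if "t \<in> T" "x \<in> X" "dist t t0 < d / 2" "dist x x0 < d / 2" for t x
  proof -
    have "dist (t, x) (t0, x0) \<le> dist t t0 + dist x x0"
      unfolding dist_Pair_Pair by (rule sqrt_sum_squares_le_sum) auto
    then have "dist (f t x) (f t0 x0) < r" using d(2)[OF that(1,2)] that by linarith
    moreover have "f t x \<in> X" using f(2) that(1,2) by blast
    ultimately have "f t x \<in> X \<inter> ball (\<eta> v0) r" using v0(2) by (simp add: dist_commute)
    then show ?thesis using r(2) by blast
  qed
  have oU: "open U" using lp unfolding local_parametrization_def by blast
  have "continuous (at u0) \<psi>"
    using local_parametrization_derivative(1)[OF lp u0(1)] has_derivative_continuous by blast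
  then obtain e where e: "e > 0" "\<And>u. dist u u0 < e \<Longrightarrow> dist (\<psi> u) x0 < d / 2"
    unfolding continuous_at_eps_delta using d(1) u0(2) by (metis half_gt_zero)
  obtain e' where e': "e' > 0" "ball u0 e' \<subseteq> U" using oU u0 openE by blast
  \<comment> \<open>Radii are halved here and for the times below so that closed, hence compact, balls still keep
    \<open>f t (\<psi> u)\<close> inside the image of \<open>\<eta>\<close>.\<close>
  define \<rho> where "\<rho> = min e e' / 2"
  let ?K = "cball u0 \<rho>"
  have \<rho>: "\<rho> > 0" "?K \<subseteq> U" "\<And>u. u \<in> ?K \<Longrightarrow> dist (\<psi> u) x0 < d / 2"
  proof -
    show "\<rho> > 0" using e(1) e'(1) by (simp add: \<rho>_def)
    have "dist u u0 < e \<and> dist u0 u < e'" if "u \<in> ?K" for u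
      using that e(1) e'(1) by (auto simp: \<rho>_def dist_commute)
    then show "?K \<subseteq> U" "\<And>u. u \<in> ?K \<Longrightarrow> dist (\<psi> u) x0 < d / 2"
      using e(2) e'(2) by auto
  qed
  have "ball u0 \<rho> \<subseteq> U" using \<rho>(2) ball_subset_cball by blast
  then obtain r' where r': "r' > 0" "X \<inter> ball x0 r' \<subseteq> \<psi> ` ball u0 \<rho>"
    using local_parametrization_ball_subset[OF lp open_ball, of u0 \<rho> u0] \<rho>(1) u0(2) by auto
  have \<psi>X: "\<psi> u \<in> X" if "u \<in> U" for u using local_parametrization_subset[OF lp] that by blast
  let ?D\<psi> = "\<lambda>u. frechet_derivative \<psi> (at u)"
  have c\<psi>: "continuous_on U \<psi>"
    using local_parametrization_derivative(1)[OF lp] has_derivative_at_withinI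
    by (intro has_derivative_continuous_on) blast
  \<comment> \<open>A Lipschitz constant of \<open>f t \<circ> \<psi>\<close> on \<open>?K\<close> that serves all \<open>t\<close> in \<open>?T\<close>.\<close>
  let ?T = "T \<inter> cball t0 (d / 4)"
  let ?L = "\<lambda>p a. frechet_derivative (f (fst p)) (at (\<psi> (snd p)) within X) (?D\<psi> (snd p) a)"
  have "compact (?T \<times> ?K)" using T by (intro compact_Times compact_Int_closed) auto
  moreover have "continuous_on ((?T \<times> ?K) \<times> UNIV) (\<lambda>(p, a). ?L p a)"
  proof -
    have "continuous_on ((?T \<times> ?K) \<times> UNIV)
        (\<lambda>q. (\<lambda>(t, x, v). frechet_derivative (f t) (at x within X) v)
              (fst (fst q), \<psi> (snd (fst q)), ?D\<psi> (snd (fst q)) (snd q)))"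
    proof (rule continuous_on_compose2[OF Df])
      have "continuous_on ((?T \<times> ?K) \<times> (UNIV :: (real^'d) set)) (\<lambda>q. (\<lambda>(u, a). ?D\<psi> u a) (snd (fst q), snd q))"
        using \<rho>(2) by (intro continuous_on_compose2[OF local_parametrization_derivative_continuous[OF lp]] continuous_intros) auto
      moreover have "continuous_on ((?T \<times> ?K) \<times> (UNIV :: (real^'d) set)) (\<lambda>q. \<psi> (snd (fst q)))"
        using \<rho>(2) by (intro continuous_on_compose2[OF c\<psi>] continuous_intros) auto
      ultimately show "continuous_on ((?T \<times> ?K) \<times> (UNIV :: (real^'d) set))
          (\<lambda>q. (fst (fst q), \<psi> (snd (fst q)), ?D\<psi> (snd (fst q)) (snd q)))"
        by (intro continuous_intros) auto
      have "(\<psi> u, ?D\<psi> u a) \<in> tangent_bundle X" if "u \<in> ?K" for u a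
        using that \<rho>(2) \<psi>X tangent_space_parametrization[OF lp] unfolding tangent_bundle_def by blast
      then show "(\<lambda>q. (fst (fst q), \<psi> (snd (fst q)), ?D\<psi> (snd (fst q)) (snd q))) ` ((?T \<times> ?K) \<times> UNIV)
          \<subseteq> T \<times> tangent_bundle X" by auto
    qed
    then show ?thesis by (simp add: case_prod_beta')
  qed
  moreover have "linear (?L p)" if "p \<in> ?T \<times> ?K" for p
  proof -
    have "snd p \<in> U" "fst p \<in> T" using that \<rho>(2) by auto
    then show ?thesis
      using linear_compose[OF local_parametrization_derivative(2)[OF lp] frechet_derivative_linear[OF f(1)]] \<psi>X
      by (auto simp: comp_def)
  qed
  ultimately obtain C where C: "C > 0" "\<And>p a. p \<in> ?T \<times> ?K \<Longrightarrow> norm (?L p a) \<le> C * norm a"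
    using linear_family_bounded_on_compact[of "?T \<times> ?K" ?L] by blast
  have lip: "norm (f t (\<psi> u) - f t (\<psi> u')) \<le> C * norm (u - u')"
    if t: "t \<in> ?T" and u: "u \<in> ?K" "u' \<in> ?K" for t u u'
  proof (rule differentiable_bound[of ?K "\<lambda>u. f t (\<psi> u)" "\<lambda>u. ?L (t, u)"])
    fix w assume w: "w \<in> ?K"
    then have wU: "w \<in> U" using \<rho>(2) by blast
    have "(f t has_derivative frechet_derivative (f t) (at (\<psi> w) within X)) (at (\<psi> w) within X)"
      using f(1) t \<psi>X[OF wU] frechet_derivative_works by blast
    then have "(f t has_derivative frechet_derivative (f t) (at (\<psi> w) within X)) (at (\<psi> w) within \<psi> ` ?K)"
      by (rule has_derivative_subset) (use \<rho>(2) \<psi>X in blast)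
    from diff_chain_within[OF has_derivative_at_withinI[OF local_parametrization_derivative(1)[OF lp wU]] this]
    show "((\<lambda>u. f t (\<psi> u)) has_derivative ?L (t, w)) (at w within ?K)" by (simp add: comp_def)
    show "onorm (?L (t, w)) \<le> C" using t w C by (intro onorm_le) auto
  qed (use u in auto)
  have cK: "compact ?K" "?K \<noteq> {}" using \<rho>(1) by auto
  obtain a where a: "a > 0" "\<And>u. u \<in> ?K \<Longrightarrow> a \<le> volume_density \<psi> u"
    using continuous_attains_inf[OF cK continuous_on_subset[OF volume_density_continuous[OF lp] \<rho>(2)]]
      volume_density_pos[OF lp] \<rho>(2) by (metis subsetD)
  have cK': "compact (cball v0 \<sigma>)" "cball v0 \<sigma> \<noteq> {}" using \<sigma>(1) by auto
  obtain b where b: "b > 0" "\<And>u. u \<in> cball v0 \<sigma> \<Longrightarrow> volume_density \<eta> u \<le> b"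
    using continuous_attains_sup[OF cK' continuous_on_subset[OF volume_density_continuous[OF lp'] \<sigma>(3)]]
      volume_density_pos[OF lp'] \<sigma>(3) by (metis subsetD)
  define k where "k = (2 * (C / c) * DIM(real^'d)) ^ DIM(real^'d)"
  have k0: "k \<ge> 0" unfolding k_def using C(1) \<sigma>(2) by simp
  have dens: "emeasure \<nu> (\<psi>' ` S) = (\<integral>\<^sup>+u\<in>S. ennreal (volume_density \<psi>' u) \<partial>lborel)"
    if "local_parametrization X U' \<psi>'" "S \<in> sets borel" "S \<subseteq> U'" for U' S and \<psi>' :: "real^'d \<Rightarrow> 'a"
    using \<nu> that unfolding volume_measure_def by blast
  have bound: "emeasure \<nu> (f t ` A) \<le> ennreal (b * k / a) * emeasure \<nu> A"
    if t: "t \<in> ?T" and A: "A \<in> sets \<nu>" "A \<subseteq> ball x0 r'" for t A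
  proof -
    define S where "S = ?K \<inter> \<psi> -` A"
    define S' where "S' = cball v0 \<sigma> \<inter> \<eta> -` (f t ` A)"
    have AX: "A \<subseteq> X" "A \<in> sets borel" "f t ` A \<in> sets borel"
      using A fA[of t A] t sets_nu by auto
    have S: "S \<in> sets borel" "S \<subseteq> ?K" "\<psi> ` S = A"
    proof -
      show "S \<in> sets borel" unfolding S_def
        using AX by (intro borel_continuous_preimage continuous_on_subset[OF c\<psi> \<rho>(2)]) auto
      show "\<psi> ` S = A" using r'(2) AX A(2) ball_subset_cball unfolding S_def by blast
    qed (auto simp: S_def)
    have c\<eta>: "continuous_on V \<eta>"
      using local_parametrization_derivative(1)[OF lp'] has_derivative_at_withinI
      by (intro has_derivative_continuous_on) blast
    have S': "S' \<in> sets borel" "S' \<subseteq> cball v0 \<sigma>"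
      unfolding S'_def using AX by (auto intro!: borel_continuous_preimage continuous_on_subset[OF c\<eta> \<sigma>(3)])
    have inK: "f t (\<psi> u) \<in> \<eta> ` ball v0 \<sigma>" if "u \<in> ?K" for u
      using d2[of t "\<psi> u"] that \<rho>(2,3) \<psi>X t d(1) by (auto simp: dist_commute)
    define \<theta> where "\<theta> u = inv_into (ball v0 \<sigma>) \<eta> (f t (\<psi> u))" for u
    have \<theta>: "\<theta> u \<in> cball v0 \<sigma>" "\<eta> (\<theta> u) = f t (\<psi> u)" if "u \<in> ?K" for u
      using inv_into_into[OF inK[OF that]] f_inv_into_f[OF inK[OF that]] unfolding \<theta>_def by auto
    have inj: "w = w'" if "w \<in> cball v0 \<sigma>" "w' \<in> cball v0 \<sigma>" "\<eta> w = \<eta> w'" for w w'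
      using \<sigma>(4)[OF that(1,2)] that(3) \<sigma>(2) by (simp add: mult_le_0_iff)
    have \<theta>S: "\<theta> ` S = S'"
    proof
      show "\<theta> ` S \<subseteq> S'" using \<theta> S unfolding S'_def by auto
      show "S' \<subseteq> \<theta> ` S"
      proof
        fix w assume "w \<in> S'"
        then obtain u where u: "u \<in> S" "w \<in> cball v0 \<sigma>" "\<eta> w = f t (\<psi> u)"
          unfolding S'_def using S(3) by blast
        then have "w = \<theta> u" using inj \<theta>[of u] S(2) by auto
        then show "w \<in> \<theta> ` S" using u(1) by blast
      qed
    qed
    have img: "\<eta> ` S' = f t ` A"
      unfolding \<theta>S[symmetric] image_image using \<theta>(2) S(2) by (subst S(3)[symmetric]) (force simp: image_image)
    have lS: "S \<in> lmeasurable" "bounded S"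
      using fmeasurableI2[OF lmeasurable_cball S(2)] S(1) bounded_subset[OF bounded_cball S(2)] by auto
    have \<theta>lip: "norm (\<theta> u - \<theta> u') \<le> C / c * norm (u - u')" if "u \<in> S" "u' \<in> S" for u u'
    proof -
      have uK: "u \<in> ?K" "u' \<in> ?K" using that S(2) by auto
      have "c * norm (\<theta> u - \<theta> u') \<le> C * norm (u - u')"
        using \<sigma>(4)[OF \<theta>(1)[OF uK(1)] \<theta>(1)[OF uK(2)]] lip[OF t uK] \<theta>(2) uK by simp
      then show ?thesis using \<sigma>(2) by (simp add: field_simps)
    qed
    have S'l: "\<theta> ` S \<in> sets lebesgue" unfolding \<theta>S using S'(1) by auto
    have "0 \<le> C / c" using C(1) \<sigma>(2) by simp
    note m = measure_lipschitz_image_le[OF lS S'l this \<theta>lip, unfolded \<theta>S, folded k_def]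
    have "emeasure lborel S' = emeasure lebesgue S'" "emeasure lborel S = emeasure lebesgue S"
      using S'(1) S(1) by (simp_all add: emeasure_completion)
    then have vol: "emeasure lborel S' \<le> ennreal k * emeasure lborel S"
      using m lS(1) k0 by (simp add: emeasure_eq_measure2 flip: ennreal_mult)
    have "emeasure \<nu> (f t ` A) = (\<integral>\<^sup>+u\<in>S'. ennreal (volume_density \<eta> u) \<partial>lborel)"
      using dens[OF lp' S'(1)] S'(2) \<sigma>(3) unfolding img by blast
    also have "\<dots> \<le> (\<integral>\<^sup>+u\<in>S'. ennreal b \<partial>lborel)"
      using b(2) subsetD[OF S'(2)]
      by (intro nn_integral_mono) (simp add: indicator_def ennreal_leI del: mem_cball)
    also have "\<dots> = ennreal b * emeasure lborel S'"
      using S'(1) by (simp add: nn_integral_cmult_indicator)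
    also have "\<dots> \<le> ennreal b * (ennreal k * emeasure lborel S)"
      by (intro mult_left_mono vol) auto
    also have "\<dots> = ennreal (b * k / a) * (ennreal a * emeasure lborel S)"
      using a(1) b(1) k0 by (simp add: mult.assoc[symmetric] flip: ennreal_mult)
    also have "ennreal a * emeasure lborel S = (\<integral>\<^sup>+u\<in>S. ennreal a \<partial>lborel)"
      using S(1) by (simp add: nn_integral_cmult_indicator)
    also have "\<dots> \<le> (\<integral>\<^sup>+u\<in>S. ennreal (volume_density \<psi> u) \<partial>lborel)"
      using a(2) subsetD[OF S(2)]
      by (intro nn_integral_mono) (simp add: indicator_def ennreal_leI del: mem_cball)
    also have "\<dots> = emeasure \<nu> A"
      using dens[OF lp S(1)] S(2) \<rho>(2) unfolding S(3) by simp
    finally show ?thesis by (simp add: mult_left_mono)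
  qed
  have "b * k / a \<ge> 0" using a b k0 by simp
  moreover have "min (d / 4) r' > 0" using d(1) r'(1) by simp
  moreover have "\<forall>t\<in>T \<inter> ball t0 (min (d / 4) r'). \<forall>A\<in>sets \<nu>. A \<subseteq> ball x0 (min (d / 4) r') \<longrightarrow>
      emeasure \<nu> (f t ` A) \<le> ennreal (b * k / a) * emeasure \<nu> A"
  proof (intro ballI impI)
    fix t A assume "t \<in> T \<inter> ball t0 (min (d / 4) r')" "A \<in> sets \<nu>" "A \<subseteq> ball x0 (min (d / 4) r')"
    moreover have "ball x0 (min (d / 4) r') \<subseteq> ball x0 r'" by (rule subset_ball) simp
    ultimately show "emeasure \<nu> (f t ` A) \<le> ennreal (b * k / a) * emeasure \<nu> A"
      by (intro bound) auto
  qed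
  ultimately show ?thesis by blast
qed

text \<open>
Compactness of \<open>T \<times> X\<close> makes the local bounds uniform.  This is what keeps the images of small sets
small simultaneously for all times in a compact interval.
\<close>

lemma volume_image_bound:
  fixes X :: "'a::euclidean_space set" and f :: "real \<Rightarrow> 'a \<Rightarrow> 'a"
  assumes X: "compact_smooth_manifold TYPE('d::finite) X" and \<nu>: "volume_measure TYPE('d) X \<nu>"
    and T: "compact T"
    and f: "\<And>t x. t \<in> T \<Longrightarrow> x \<in> X \<Longrightarrow> f t differentiable (at x within X)"
      "\<And>t. t \<in> T \<Longrightarrow> f t ` X \<subseteq> X"
    and cf: "continuous_on (T \<times> X) (\<lambda>(t, x). f t x)"
    and Df: "continuous_on (T \<times> tangent_bundle X) (\<lambda>(t, x, v). frechet_derivative (f t) (at x within X) v)"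
    and fA: "\<And>t A. t \<in> T \<Longrightarrow> A \<in> sets \<nu> \<Longrightarrow> f t ` A \<in> sets \<nu>"
  shows "\<exists>C\<ge>0. \<forall>t\<in>T. \<forall>A\<in>sets \<nu>. emeasure \<nu> (f t ` A) \<le> ennreal C * emeasure \<nu> A"
proof -
  have cX: "compact X" using X unfolding compact_smooth_manifold_def by blast
  note sets_nu = sets_volume_measure_iff[OF \<nu> cX]
  have "\<exists>\<delta> C. \<delta> > 0 \<and> C \<ge> 0 \<and> (\<forall>t\<in>T \<inter> ball (fst p) \<delta>. \<forall>A\<in>sets \<nu>. A \<subseteq> ball (snd p) \<delta> \<longrightarrow>
    emeasure \<nu> (f t ` A) \<le> ennreal C * emeasure \<nu> A)" if "p \<in> T \<times> X" for p
  proof -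
    have "fst p \<in> T" "snd p \<in> X" using that by auto
    from volume_local_image_bound[OF X \<nu> T f cf Df fA this] show ?thesis by blast
  qed
  then have "\<forall>p\<in>T \<times> X. \<exists>q. fst q > 0 \<and> snd q \<ge> 0 \<and> (\<forall>t\<in>T \<inter> ball (fst p) (fst q). \<forall>A\<in>sets \<nu>.
    A \<subseteq> ball (snd p) (fst q) \<longrightarrow> emeasure \<nu> (f t ` A) \<le> ennreal (snd q) * emeasure \<nu> A)"
    by simp
  then obtain q where q: "\<forall>p\<in>T \<times> X. fst (q p) > 0 \<and> snd (q p) \<ge> 0 \<and>
    (\<forall>t\<in>T \<inter> ball (fst p) (fst (q p)). \<forall>A\<in>sets \<nu>. A \<subseteq> ball (snd p) (fst (q p)) \<longrightarrow>
      emeasure \<nu> (f t ` A) \<le> ennreal (snd (q p)) * emeasure \<nu> A)"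
    unfolding bchoice_iff by blast
  define \<delta> C where "\<delta> p = fst (q p)" and "C p = snd (q p)" for p
  have dC: "\<And>p. p \<in> T \<times> X \<Longrightarrow> \<delta> p > 0" "\<And>p. p \<in> T \<times> X \<Longrightarrow> C p \<ge> 0"
    "\<And>p t A. p \<in> T \<times> X \<Longrightarrow> t \<in> T \<Longrightarrow> t \<in> ball (fst p) (\<delta> p) \<Longrightarrow> A \<in> sets \<nu> \<Longrightarrow> A \<subseteq> ball (snd p) (\<delta> p) \<Longrightarrow>
      emeasure \<nu> (f t ` A) \<le> ennreal (C p) * emeasure \<nu> A"
    using q unfolding \<delta>_def C_def by blast+
  let ?O = "\<lambda>p. ball (fst p) (\<delta> p) \<times> ball (snd p) (\<delta> p)"
  have "compact (T \<times> X)" using T cX by (rule compact_Times)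
  moreover have "\<And>p. p \<in> T \<times> X \<Longrightarrow> open (?O p)" by (intro open_Times open_ball)
  moreover have "T \<times> X \<subseteq> (\<Union>p\<in>T \<times> X. ?O p)" using dC(1) by fastforce
  ultimately obtain F where F: "F \<subseteq> T \<times> X" "finite F" "T \<times> X \<subseteq> (\<Union>p\<in>F. ?O p)"
    by (rule compactE_image)
  have "emeasure \<nu> (f t ` A) \<le> ennreal (\<Sum>p\<in>F. C p) * emeasure \<nu> A" if t: "t \<in> T" and A: "A \<in> sets \<nu>" for t A
  proof -
    define G where "G = {p \<in> F. t \<in> ball (fst p) (\<delta> p)}"
    have G: "finite G" "G \<subseteq> F" using F(2) by (auto simp: G_def)
    have AB: "A \<inter> ball (snd p) (\<delta> p) \<in> sets \<nu>" for p using A unfolding sets_nu by auto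
    have "A \<subseteq> (\<Union>p\<in>G. A \<inter> ball (snd p) (\<delta> p))"
    proof
      fix x assume "x \<in> A"
      then have "(t, x) \<in> T \<times> X" using A t sets_nu by auto
      then show "x \<in> (\<Union>p\<in>G. A \<inter> ball (snd p) (\<delta> p))" using F(3) \<open>x \<in> A\<close> unfolding G_def by fastforce
    qed
    then have "f t ` A \<subseteq> (\<Union>p\<in>G. f t ` (A \<inter> ball (snd p) (\<delta> p)))" by blast
    then have "emeasure \<nu> (f t ` A) \<le> emeasure \<nu> (\<Union>p\<in>G. f t ` (A \<inter> ball (snd p) (\<delta> p)))"
      using fA[OF t AB] G by (intro emeasure_mono) auto
    also have "\<dots> \<le> (\<Sum>p\<in>G. emeasure \<nu> (f t ` (A \<inter> ball (snd p) (\<delta> p))))"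
      using fA[OF t AB] G by (intro emeasure_subadditive_finite) auto
    also have "\<dots> \<le> (\<Sum>p\<in>G. ennreal (C p) * emeasure \<nu> (A \<inter> ball (snd p) (\<delta> p)))"
      using F(1) AB t unfolding G_def by (intro sum_mono dC(3)) auto
    also have "\<dots> \<le> (\<Sum>p\<in>G. ennreal (C p) * emeasure \<nu> A)"
      using A by (intro sum_mono mult_left_mono emeasure_mono) auto
    also have "\<dots> \<le> (\<Sum>p\<in>F. ennreal (C p) * emeasure \<nu> A)"
      using F G by (intro sum_mono2) auto
    also have "\<dots> = ennreal (\<Sum>p\<in>F. C p) * emeasure \<nu> A"
      using dC(2) F(1) by (subst sum_ennreal[symmetric]) (auto simp: sum_distrib_right)
    finally show ?thesis .
  qed
  moreover have "(\<Sum>p\<in>F. C p) \<ge> 0" using dC(2) F(1) by (intro sum_nonneg) auto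
  ultimately show ?thesis by blast
qed

section \<open>Integrals over sets transported by a continuous family\<close>

lemma finite_measure_compact_inner_approx:
  fixes M :: "'a::euclidean_space measure"
  assumes "finite_measure M" and M: "sets M = sets borel" and B: "B \<in> sets borel" and e: "\<epsilon> > 0"
  obtains K where "K \<subseteq> B" "compact K" "measure M (B - K) < \<epsilon>"
proof (cases "measure M B < \<epsilon>")
  case True
  then show ?thesis using that[of "{}"] by simp
next
  case False
  interpret finite_measure M by fact
  have "ennreal (measure M B - \<epsilon>) < emeasure M B"
    using False e by (simp add: emeasure_eq_measure ennreal_less_iff)
  also have "\<dots> = (SUP K \<in> {K. K \<subseteq> B \<and> compact K}. emeasure M K)"
    by (rule inner_regular[OF M _ B]) simp
  finally obtain K where K: "K \<subseteq> B" "compact K" "ennreal (measure M B - \<epsilon>) < emeasure M K"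
    unfolding less_SUP_iff by blast
  have "measure M B - \<epsilon> < measure M K"
    using K(3) False by (simp add: emeasure_eq_measure ennreal_less_iff)
  moreover have "measure M (B - K) = measure M B - measure M K"
    using K B M by (intro finite_measure_Diff) (auto simp: compact_imp_closed)
  ultimately show ?thesis using that K by simp
qed

text \<open>
Exhaust the set and its complement by compact sets from inside up to small measure, and take a Urysohn function
that separates them.
\<close>

lemma measurable_set_continuous_approx:
  fixes X :: "'a::euclidean_space set"
  assumes fin: "finite_measure \<mu>" and \<mu>: "sets \<mu> = sets (restrict_space borel X)" and X: "closed X"
    and A: "A \<in> sets (completion \<mu>)" and e: "\<epsilon> > 0"
  obtains h :: "'a \<Rightarrow> real" and E where "continuous_on UNIV h" "\<And>x. 0 \<le> h x \<and> h x \<le> 1"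
    "E \<in> sets \<mu>" "measure \<mu> E < \<epsilon>" "\<And>x. x \<in> X - E \<Longrightarrow> h x = indicator A x"
proof -
  interpret finite_measure \<mu> by fact
  have sp: "space \<mu> = X" using sets_eq_imp_space_eq[OF \<mu>] by (simp add: space_restrict_space)
  have Xb: "X \<in> sets borel" using X by simp
  have sets: "B \<in> sets \<mu> \<longleftrightarrow> B \<in> sets borel \<and> B \<subseteq> X" for B
    using Xb unfolding \<mu> by (simp add: sets_restrict_space_iff conj_commute)
  obtain S N N' where S: "A = S \<union> N" "N \<subseteq> N'" "N' \<in> null_sets \<mu>" "S \<in> sets \<mu>"
    using sets_completionE[OF A] by blast
  let ?M = "distr \<mu> borel (\<lambda>x. x)"
  have idm: "(\<lambda>x. x) \<in> measurable \<mu> borel"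
    unfolding measurable_cong_sets[OF \<mu> refl] by (intro measurable_restrict_space1) simp
  interpret M: finite_measure ?M by (rule finite_measure_distr[OF idm])
  have M: "measure ?M B = measure \<mu> (B \<inter> X)" if "B \<in> sets borel" for B
    using that by (simp add: measure_distr[OF idm] sp)
  have Sb: "S \<in> sets borel" "S \<subseteq> X" using S(4) sets by auto
  obtain K where K: "K \<subseteq> S" "compact K" "measure ?M (S - K) < \<epsilon> / 2"
    using finite_measure_compact_inner_approx[OF M.finite_measure_axioms, of S "\<epsilon> / 2"] Sb e by auto
  obtain K' where K': "K' \<subseteq> - S" "compact K'" "measure ?M (- S - K') < \<epsilon> / 2"
    using finite_measure_compact_inner_approx[OF M.finite_measure_axioms, of "- S" "\<epsilon> / 2"] Sb e by auto
  obtain h :: "'a \<Rightarrow> real" where h: "continuous_on UNIV h" "\<And>x. h x \<in> closed_segment 1 0"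
     "\<And>x. x \<in> K \<Longrightarrow> h x = 1" "\<And>x. x \<in> K' \<Longrightarrow> h x = 0"
    using Urysohn[of K K' "1::real" 0] K K' compact_imp_closed by (metis disjoint_eq_subset_Compl subset_trans compl_le_swap1)
  \<comment> \<open>The set \<open>N'\<close> accounts for the points of \<open>A\<close> outside its Borel part \<open>S\<close>.\<close>
  define E where "E = (S - K) \<union> (X \<inter> (- S - K')) \<union> N'"
  have Kb: "K \<in> sets borel" "K' \<in> sets borel" using K K' by (auto simp: compact_imp_closed)
  have 1: "S - K \<in> sets \<mu>" "X \<inter> (- S - K') \<in> sets \<mu>" "N' \<in> sets \<mu>"
    using Sb Kb Xb S(3) unfolding sets by (auto simp: sets null_sets_def)
  have "measure \<mu> E \<le> measure \<mu> (S - K) + measure \<mu> (X \<inter> (- S - K')) + measure \<mu> N'"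
    unfolding E_def
    using measure_Un_le[OF sets.Un[OF 1(1,2)] 1(3)] measure_Un_le[OF 1(1,2)] by linarith
  moreover have "measure \<mu> N' = 0" using S(3) by (simp add: measure_eq_0_null_sets)
  moreover have "measure \<mu> (S - K) < \<epsilon> / 2"
    using K(3) M[of "S - K"] Sb Kb by (simp add: Int_absorb2 Diff_subset subset_trans[OF Diff_subset])
  moreover have "measure \<mu> (X \<inter> (- S - K')) < \<epsilon> / 2"
    using K'(3) M[of "- S - K'"] Sb Kb by (simp add: Int_commute)
  ultimately have "measure \<mu> E < \<epsilon>" by simp
  moreover have "E \<in> sets \<mu>" using 1 by (simp add: E_def)
  moreover have "0 \<le> h x \<and> h x \<le> 1" for x using h(2)[of x] by (auto simp: closed_segment_eq_real_ivl)
  moreover have "h x = indicator A x" if "x \<in> X - E" for x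
    using that h(3,4) S(1,2) K(1) unfolding E_def by (cases "x \<in> S") (auto simp: indicator_def)
  ultimately show ?thesis using that h(1) by blast
qed

text \<open>
For a continuous \<open>h\<close> in place of the indicator of \<open>A\<close> the integrand is uniformly continuous on \<open>T \<times> X\<close>, and
the integrals converge.  A continuous \<open>h\<close> can be made to agree with the indicator of \<open>A\<close> outside a set
\<open>E\<close> of small measure; along \<open>g t\<close> the two then differ only on \<open>f t ` E\<close>, whose measure is small for all
\<open>t\<close> at once by the bound with constant \<open>C\<close>.  The same bound sends null sets to null sets, which gives
measurability with respect to the completed measure.
\<close>

lemma transported_set_integral:
  fixes X :: "'a::euclidean_space set" and f g :: "real \<Rightarrow> 'a \<Rightarrow> 'a" and J :: "real \<Rightarrow> 'a \<Rightarrow> real"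
  assumes fin: "prob_space \<mu>" and \<mu>: "sets \<mu> = sets (restrict_space borel X)" and X: "compact X"
    and T: "compact T" "N \<in> T"
    and g: "continuous_on (T \<times> X) (\<lambda>(t, x). g t x)" and J: "continuous_on (T \<times> X) (\<lambda>(t, x). J t x)"
    and maps: "\<And>t x. t \<in> T \<Longrightarrow> x \<in> X \<Longrightarrow> g t x \<in> X \<and> f t (g t x) = x"
      "\<And>t x. t \<in> T \<Longrightarrow> x \<in> X \<Longrightarrow> f t x \<in> X \<and> g t (f t x) = x"
    and fA: "\<And>t A. t \<in> T \<Longrightarrow> A \<in> sets \<mu> \<Longrightarrow> f t ` A \<in> sets \<mu>"
    and C: "C \<ge> 0" "\<And>t A. t \<in> T \<Longrightarrow> A \<in> sets \<mu> \<Longrightarrow> emeasure \<mu> (f t ` A) \<le> ennreal C * emeasure \<mu> A"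
    and A: "A \<in> sets (completion \<mu>)" and B: "B \<in> sets (completion \<mu>)"
  shows "\<And>t. t \<in> T \<Longrightarrow> integrable (completion \<mu>) (\<lambda>x. indicator A (g t x) * J t x)"
    and "((\<lambda>t. LINT x:B|completion \<mu>. indicator A (g t x) * J t x) \<longlongrightarrow>
            (LINT x:B|completion \<mu>. indicator A (g N x) * J N x)) (at N within T)"
proof -
  interpret prob_space \<mu> by fact
  let ?m = "completion \<mu>"
  interpret m: prob_space ?m by (rule prob_space_completion)
  have sp: "space \<mu> = X" using sets_eq_imp_space_eq[OF \<mu>] by (simp add: space_restrict_space)
  have Xb: "X \<in> sets borel" using X by (simp add: compact_imp_closed)
  have meas: "k \<in> borel_measurable ?m" if "continuous_on X k" for k :: "'a \<Rightarrow> real"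
    unfolding measurable_cong_sets[OF \<mu> refl]
    by (intro measurable_completion, subst measurable_cong_sets[OF \<mu> refl])
       (rule borel_measurable_continuous_on_restrict[OF that])
  have slice: "continuous_on X (k t)" if "continuous_on (T \<times> X) (\<lambda>(t, x). k t x)" "t \<in> T"
    for t and k :: "real \<Rightarrow> 'a \<Rightarrow> 'b::topological_space"
    using continuous_on_compose2[OF that(1) continuous_on_Pair[OF continuous_on_const continuous_on_id]] that(2)
    by auto
  have "bounded ((\<lambda>(t, x). J t x) ` (T \<times> X))"
    using T(1) X J by (intro compact_imp_bounded compact_continuous_image compact_Times)
  then obtain b where b: "b > 0" "\<And>t x. t \<in> T \<Longrightarrow> x \<in> X \<Longrightarrow> \<bar>J t x\<bar> \<le> b"
    unfolding bounded_pos by auto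
  have preim: "{x \<in> X. g t x \<in> A} \<in> sets ?m" if t: "t \<in> T" for t
  proof -
    obtain S Z Z' where S: "A = S \<union> Z" "Z \<subseteq> Z'" "Z' \<in> null_sets \<mu>" "S \<in> sets \<mu>"
      using sets_completionE[OF A] by blast
    have *: "{x \<in> X. g t x \<in> Y} = f t ` Y" if "Y \<subseteq> X" for Y
      using maps[OF t] that by (force simp: image_iff)
    have sub: "S \<subseteq> X" "Z' \<subseteq> X" using S sets.sets_into_space sp by (auto simp: null_sets_def)
    have "{x \<in> X. g t x \<in> A} = f t ` S \<union> {x \<in> X. g t x \<in> Z}" unfolding S(1) *[OF sub(1), symmetric] by auto
    moreover have "{x \<in> X. g t x \<in> Z} \<subseteq> f t ` Z'" unfolding *[OF sub(2), symmetric] using S(2) by auto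
    moreover have "f t ` Z' \<in> null_sets \<mu>"
      using C(2)[OF t, of Z'] fA[OF t, of Z'] S(3) by (auto simp: null_sets_def)
    moreover have "f t ` S \<in> sets \<mu>" using fA[OF t S(4)] .
    ultimately show ?thesis by (rule sets_completionI)
  qed
  have indm: "(\<lambda>x. indicator A (g t x) :: real) \<in> borel_measurable ?m" if t: "t \<in> T" for t
  proof -
    have "(\<lambda>x. indicator {x \<in> X. g t x \<in> A} x :: real) \<in> borel_measurable ?m"
      using preim[OF t] by simp
    then show ?thesis by (rule measurable_cong[THEN iffD1, rotated]) (simp add: sp indicator_def)
  qed
  show int: "integrable ?m (\<lambda>x. indicator A (g t x) * J t x)" if t: "t \<in> T" for t
    using b(1) b(2)[OF t] sp
    by (intro m.integrable_const_bound[where B = b] AE_I2 borel_measurable_times indm[OF t] meas slice[OF J t])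
       (auto simp: indicator_def)
  have setint: "set_integrable ?m B k" if "integrable ?m k" for k :: "'a \<Rightarrow> real"
    unfolding set_integrable_def using B that by (rule integrable_mult_indicator)
  let ?I = "\<lambda>t. LINT x:B|?m. indicator A (g t x) * J t x"
  show "(?I \<longlongrightarrow> ?I N) (at N within T)"
  proof (rule tendstoI)
    fix \<epsilon> :: real assume e: "\<epsilon> > 0"
    \<comment> \<open>Chosen so that \<open>b * C * \<epsilon>1 \<le> \<epsilon> / 4\<close>; the summand \<open>1\<close> avoids a division by zero when \<open>C = 0\<close>.\<close>
    define \<epsilon>1 where "\<epsilon>1 = \<epsilon> / (4 * (b * C + 1))"
    have bC: "b * C + 1 > 0" using b(1) C(1) by (simp add: add_nonneg_pos)
    then have e1: "\<epsilon>1 > 0" using e by (simp add: \<epsilon>1_def)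
    have e1': "b * (C * \<epsilon>1) \<le> \<epsilon> / 4"
    proof -
      have "b * C * \<epsilon>1 \<le> (b * C + 1) * \<epsilon>1" using e1 by (intro mult_right_mono) auto
      also have "\<dots> = \<epsilon> / 4" using bC by (simp add: \<epsilon>1_def field_simps)
      finally show ?thesis by (simp add: mult.assoc)
    qed
    obtain h :: "'a \<Rightarrow> real" and E where h: "continuous_on UNIV h" "\<And>x. 0 \<le> h x \<and> h x \<le> 1"
      "E \<in> sets \<mu>" "measure \<mu> E < \<epsilon>1" "\<And>x. x \<in> X - E \<Longrightarrow> h x = indicator A x"
      using measurable_set_continuous_approx[OF finite_measure_axioms \<mu> compact_imp_closed[OF X] A e1] by blast
    let ?k = "\<lambda>t x. h (g t x) * J t x"
    have ck: "continuous_on (T \<times> X) (\<lambda>(t, x). ?k t x)"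
      using continuous_on_mult[OF continuous_on_compose2[OF h(1) g] J] by (simp add: case_prod_beta')
    have kint: "integrable ?m (?k t)" if t: "t \<in> T" for t
    proof (intro m.integrable_const_bound[where B = b] AE_I2 meas slice[OF ck t])
      fix x assume "x \<in> space ?m"
      then have "\<bar>h (g t x)\<bar> * \<bar>J t x\<bar> \<le> 1 * b"
        using b(2)[OF t, of x] h(2)[of "g t x"] sp by (intro mult_mono) auto
      then show "norm (?k t x) \<le> b" by (simp add: abs_mult)
    qed
    let ?K = "\<lambda>t. LINT x:B|?m. ?k t x"
    have close: "\<bar>?I t - ?K t\<bar> \<le> \<epsilon> / 4" if t: "t \<in> T" for t
    proof -
      have fE: "f t ` E \<in> sets \<mu>" using fA[OF t h(3)] .
      have "?I t - ?K t = (LINT x:B|?m. (indicator A (g t x) * J t x - ?k t x))"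
        by (intro set_integral_diff(2)[symmetric] setint int kint t)
      also have "\<bar>\<dots>\<bar> \<le> (LINT x|?m. \<bar>indicator B x *\<^sub>R (indicator A (g t x) * J t x - ?k t x)\<bar>)"
        unfolding set_lebesgue_integral_def by (rule integral_abs_bound)
      also have "\<dots> \<le> (LINT x|?m. b * indicator (f t ` E) x)"
      proof (rule integral_mono)
        show "integrable ?m (\<lambda>x. \<bar>indicator B x *\<^sub>R (indicator A (g t x) * J t x - ?k t x)\<bar>)"
          using int[OF t] kint[OF t] B by (intro integrable_abs integrable_mult_indicator Bochner_Integration.integrable_diff)
        show "integrable ?m (\<lambda>x. b * indicator (f t ` E) x)"
          using fE by (intro integrable_mult_right integrable_real_indicator) (auto simp: m.emeasure_eq_measure)
        fix x assume "x \<in> space ?m"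
        then have x: "x \<in> X" using sp by simp
        have gx: "g t x \<in> X" "f t (g t x) = x" using maps(1)[OF t x] by auto
        have "\<bar>indicator A (g t x) - h (g t x)\<bar> \<le> (indicator (f t ` E) x :: real)"
        proof (cases "g t x \<in> E")
          case True
          then have "x \<in> f t ` E" using gx(2) by force
          then show ?thesis using h(2)[of "g t x"] by (auto simp: indicator_def)
        next
          case False
          then show ?thesis using h(5)[of "g t x"] gx(1) by simp
        qed
        then have "\<bar>indicator A (g t x) - h (g t x)\<bar> * \<bar>J t x\<bar> \<le> indicator (f t ` E) x * b"
          using b(2)[OF t x] by (intro mult_mono) auto
        then have "\<bar>indicator A (g t x) * J t x - ?k t x\<bar> \<le> b * indicator (f t ` E) x"
          by (simp add: left_diff_distrib mult.commute flip: abs_mult)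
             (simp add: right_diff_distrib)
        then show "\<bar>indicator B x *\<^sub>R (indicator A (g t x) * J t x - ?k t x)\<bar> \<le> b * indicator (f t ` E) x"
          by (cases "x \<in> B") (use b(1) in auto)
      qed
      also have "\<dots> = b * measure \<mu> (f t ` E)" using fE sp sets.sets_into_space[OF fE] by (simp add: Int_absorb2)
      also have "\<dots> \<le> b * (C * \<epsilon>1)"
      proof -
        have "measure \<mu> (f t ` E) \<le> C * measure \<mu> E"
          using C(2)[OF t h(3)] C(1) by (simp add: emeasure_eq_measure flip: ennreal_mult)
        also have "\<dots> \<le> C * \<epsilon>1" using h(4) C(1) by (intro mult_left_mono) auto
        finally show ?thesis using b(1) by (intro mult_left_mono) auto
      qed
      finally show ?thesis using e1' by linarith
    qed
    have "uniformly_continuous_on (T \<times> X) (\<lambda>(t, x). ?k t x)"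
      using T(1) X by (intro compact_uniformly_continuous ck compact_Times)
    then obtain \<delta> where d: "\<delta> > 0" "\<And>p q. p \<in> T \<times> X \<Longrightarrow> q \<in> T \<times> X \<Longrightarrow> dist q p < \<delta> \<Longrightarrow>
        dist (case q of (t, x) \<Rightarrow> ?k t x) (case p of (t, x) \<Rightarrow> ?k t x) < \<epsilon> / 4"
      by (rule uniformly_continuous_onE[of _ _ "\<epsilon> / 4"]) (use e in auto)
    have near: "\<bar>?K t - ?K N\<bar> \<le> \<epsilon> / 4" if t: "t \<in> T" "dist t N < \<delta>" for t
    proof -
      have "?K t - ?K N = (LINT x:B|?m. (?k t x - ?k N x))"
        by (intro set_integral_diff(2)[symmetric] setint kint t T(2))
      also have "\<bar>\<dots>\<bar> \<le> (LINT x|?m. \<bar>indicator B x *\<^sub>R (?k t x - ?k N x)\<bar>)"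
        unfolding set_lebesgue_integral_def by (rule integral_abs_bound)
      also have "\<dots> \<le> (LINT x|?m. \<epsilon> / 4)"
      proof (rule integral_mono)
        show "integrable ?m (\<lambda>x. \<bar>indicator B x *\<^sub>R (?k t x - ?k N x)\<bar>)"
          using kint[OF t(1)] kint[OF T(2)] B
          by (intro integrable_abs integrable_mult_indicator Bochner_Integration.integrable_diff)
        fix x assume "x \<in> space ?m"
        then have "x \<in> X" using sp by simp
        then have "\<bar>?k t x - ?k N x\<bar> < \<epsilon> / 4"
          using d(2)[of "(N, x)" "(t, x)"] t T(2) by (simp add: dist_Pair_Pair dist_real_def)
        then show "\<bar>indicator B x *\<^sub>R (?k t x - ?k N x)\<bar> \<le> \<epsilon> / 4"
          using e by (cases "x \<in> B") auto
      qed auto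
      also have "\<dots> = \<epsilon> / 4" using m.prob_space by simp
      finally show ?thesis .
    qed
    have "dist (?I t) (?I N) < \<epsilon>" if t: "t \<in> T" "dist t N < \<delta>" for t
      using close[OF t(1)] close[OF T(2)] near[OF t] e unfolding dist_real_def by linarith
    then show "\<forall>\<^sub>F t in at N within T. dist (?I t) (?I N) < \<epsilon>"
      unfolding eventually_at using d(1) by blast
  qed
qed

lemma L1_norm_step_function_diff_le:
  fixes B :: "'n::finite \<Rightarrow> 'a set"
  assumes fin: "finite_measure m" and B: "\<And>i. B i \<in> sets m"
  shows "L1_norm m (\<lambda>x. step_function B c x - step_function B c' x)
    \<le> (\<Sum>i\<in>UNIV. \<bar>c $ i - c' $ i\<bar> * measure m (B i))"
proof -
  interpret finite_measure m by fact
  have bi: "integrable m (\<lambda>x. k * indicator (B i) x)" for i and k :: real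
    using B by (intro integrable_mult_right integrable_real_indicator) (auto simp: emeasure_eq_measure)
  have "L1_norm m (\<lambda>x. step_function B c x - step_function B c' x)
      \<le> (LINT x|m. (\<Sum>i\<in>UNIV. \<bar>c $ i - c' $ i\<bar> * indicator (B i) x))"
    unfolding L1_norm_def
  proof (rule integral_mono)
    show "integrable m (\<lambda>x. \<bar>step_function B c x - step_function B c' x\<bar>)"
      unfolding step_function_def
      by (intro integrable_abs Bochner_Integration.integrable_diff Bochner_Integration.integrable_sum bi)
    show "integrable m (\<lambda>x. \<Sum>i\<in>UNIV. \<bar>c $ i - c' $ i\<bar> * indicator (B i) x)"
      by (intro Bochner_Integration.integrable_sum bi)
    fix x
    have "step_function B c x - step_function B c' x = (\<Sum>i\<in>UNIV. (c $ i - c' $ i) * indicator (B i) x)"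
      by (simp add: step_function_def sum_subtractf left_diff_distrib)
    also have "\<bar>\<dots>\<bar> \<le> (\<Sum>i\<in>UNIV. \<bar>(c $ i - c' $ i) * indicator (B i) x\<bar>)" by (rule sum_abs)
    finally show "\<bar>step_function B c x - step_function B c' x\<bar> \<le> (\<Sum>i\<in>UNIV. \<bar>c $ i - c' $ i\<bar> * indicator (B i) x)"
      by (simp add: abs_mult)
  qed
  also have "\<dots> = (\<Sum>i\<in>UNIV. \<bar>c $ i - c' $ i\<bar> * measure m (B i))"
  proof -
    have "B i \<inter> space m = B i" for i using sets.sets_into_space[OF B] by (simp add: Int_absorb2)
    moreover have "integrable m (indicat_real (B i))" for i using bi[of 1 i] by simp
    ultimately show ?thesis by (subst Bochner_Integration.integral_sum) auto
  qed
  finally show ?thesis .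
qed

section \<open>Continuity in the push-forward time\<close>

theorem proposition1:
  fixes X :: "'a::euclidean_space set"
    and m :: "'a measure"
    and \<Xi> :: "'z::euclidean_space set"
    and g :: "'z \<Rightarrow> 'z"
    and \<xi> :: "real \<Rightarrow> 'z \<Rightarrow> 'z"
    and P :: "'z measure"
    and F :: "'z \<Rightarrow> 'a \<Rightarrow> 'a"
    and \<phi> :: "real \<Rightarrow> 'z \<Rightarrow> 'a \<Rightarrow> 'a"
    and B :: "'n::finite \<Rightarrow> 'a set"
    and u :: "real \<Rightarrow> 'z \<Rightarrow> real^'n"
    and z :: 'z and M N :: real
  assumes "DIM('a) \<ge> CARD('d::finite)"
    and "compact_smooth_manifold TYPE('d) X"
    and "normalised_volume TYPE('d) X m"
    and "DIM('z) \<ge> 3"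
    and "driving_system \<Xi> g \<xi> P"
    and "nonautonomous_flow X \<Xi> \<xi> F \<phi>"
    and "connected_partition X m B"
    and "normalised_choice \<Xi> m B \<xi> \<phi> u"
    and "z \<in> \<Xi>" and "M > 0" and "N \<ge> 0"
    and "dim (U2 m B \<xi> \<phi> M (\<xi> (- N) z)) = 1"
    and "dim (W2 m B \<xi> \<phi> M N z) = 1"
  shows "((\<lambda>\<delta>. L1_norm m (\<lambda>x. f_hat TYPE('d) X m B \<xi> \<phi> u (\<xi> \<delta> z) M (N + \<delta>) x
                              - f_hat TYPE('d) X m B \<xi> \<phi> u z M N x)) \<longlongrightarrow> 0) (at_right 0)"
proof -
  note X = assms(2)
  have cX: "compact X" using X unfolding compact_smooth_manifold_def by blast
  obtain \<nu> where \<nu>: "volume_measure TYPE('d) X \<nu>" and m: "m = completion (uniform_measure \<nu> X)"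
    using assms(3) unfolding normalised_volume_def by blast
  let ?\<mu> = "uniform_measure \<nu> X"
  have sets_nu: "sets \<nu> = sets (restrict_space borel X)" using \<nu> unfolding volume_measure_def by blast
  have sets_\<mu>: "sets ?\<mu> = sets (restrict_space borel X)" using sets_nu by simp
  note nu_iff = sets_volume_measure_iff[OF \<nu> cX]
  have XM: "X \<in> sets \<nu>" unfolding nu_iff using cX by (simp add: compact_imp_closed)
  have Bm: "\<And>i. B i \<in> sets m" "\<And>i. measure m (B i) > 0"
    using assms(7) unfolding connected_partition_def by auto
  \<comment> \<open>If the total volume were \<open>0\<close> or infinite, the quotients defining the uniform measure would all
    be \<open>0\<close>, against the positive measure of the partition sets.\<close>
  have "emeasure \<nu> X \<noteq> 0 \<and> emeasure \<nu> X \<noteq> \<infinity>"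
  proof (rule ccontr)
    assume "\<not> ?thesis"
    then have "emeasure ?\<mu> X = 0" using XM by (auto simp: ennreal_divide_top)
    then have "emeasure m X = 0" unfolding m using XM by (simp add: emeasure_completion)
    moreover have "B i \<subseteq> X" for i using assms(7) unfolding connected_partition_def by blast
    moreover have "X \<in> sets m" unfolding m using XM by simp
    ultimately have "emeasure m (B i) = 0" for i using emeasure_mono[of "B i" X m] by simp
    then show False using Bm(2) unfolding measure_def by simp
  qed
  then have prob: "prob_space ?\<mu>" using prob_space_uniform_measure by blast
  interpret m: prob_space m unfolding m by (rule prob_space.prob_space_completion[OF prob])
  \<comment> \<open>All the functions start at the state \<open>y\<close>; the times \<open>T\<close> form a compact neighbourhood of \<open>N\<close>.\<close>
  define y where "y = \<xi> (- N) z"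
  define T where "T = {N - 1..N + 1}"
  have flow: "\<And>t w. w \<in> \<Xi> \<Longrightarrow> \<xi> t w \<in> \<Xi>" "\<And>w. w \<in> \<Xi> \<Longrightarrow> \<xi> 0 w = w"
    "\<And>s t w. w \<in> \<Xi> \<Longrightarrow> \<xi> t (\<xi> s w) = \<xi> (t + s) w"
    using assms(5) unfolding driving_system_def autonomous_flow_def by auto
  have yX: "y \<in> \<Xi>" unfolding y_def using flow(1) assms(9) .
  note na = assms(6)[unfolded nonautonomous_flow_def]
  have phi: "\<And>t w x. w \<in> \<Xi> \<Longrightarrow> x \<in> X \<Longrightarrow> \<phi> t w x \<in> X" "\<And>w x. w \<in> \<Xi> \<Longrightarrow> x \<in> X \<Longrightarrow> \<phi> 0 w x = x"
    "\<And>s t w x. w \<in> \<Xi> \<Longrightarrow> x \<in> X \<Longrightarrow> \<phi> t (\<xi> s w) (\<phi> s w x) = \<phi> (t + s) w x"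
    using na by auto
  have diff: "\<phi> t w differentiable (at x within X)" if "w \<in> \<Xi>" "x \<in> X" for t w x
    using na that unfolding C1_diffeomorphism_def C1_on_manifold_def by blast
  let ?f = "\<lambda>t. \<phi> t y" and ?g = "\<lambda>t. \<phi> (- t) (\<xi> t y)"
  let ?J = "\<lambda>t. abs_det_deriv TYPE('d) X (?g t)"
  have maps: "?g t x \<in> X \<and> ?f t (?g t x) = x" "?f t x \<in> X \<and> ?g t (?f t x) = x" if "x \<in> X" for t x
    using phi(1)[OF _ that] phi(3)[OF flow(1)[OF yX] that, of t "- t" t] phi(3)[OF yX that, of "- t" t]
      phi(2)[OF _ that] flow(1)[OF yX] flow(3)[OF yX, of "- t" t] flow(2)[OF yX] yX by auto
  have cf: "continuous_on (T \<times> X) (\<lambda>(t, x). ?f t x)"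
    using na yX by (meson continuous_on_subset Sigma_mono subset_UNIV order_refl)
  have Df: "continuous_on (T \<times> tangent_bundle X) (\<lambda>(t, x, v). frechet_derivative (?f t) (at x within X) v)"
    using na yX by (meson continuous_on_subset Sigma_mono subset_UNIV order_refl)
  have fX: "?f t ` X \<subseteq> X" for t using maps(2) by blast
  have cT: "compact T" unfolding T_def by simp
  have cg: "continuous_on (T \<times> X) (\<lambda>(t, x). ?g t x)"
    by (rule continuous_on_inverse_family[OF cT cX cf]) (use maps in auto)
  have cJ: "continuous_on (T \<times> X) (\<lambda>(t, x). ?J t x)"
  proof -
    have inv: "?J t x * abs_det_deriv TYPE('d) X (?f t) (?g t x) = 1" if "x \<in> X" for t x
      using abs_det_deriv_inverse[OF X, of "?g t x" "?f t" "?g t"] maps[of _ t] that fX diff yX flow(1)[OF yX]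
      by auto
    have "continuous_on (T \<times> X) (\<lambda>p. 1 / (\<lambda>(t, x). abs_det_deriv TYPE('d) X (?f t) x) (fst p, (\<lambda>(t, x). ?g t x) p))"
    proof (intro continuous_intros continuous_on_compose2[OF abs_det_deriv_continuous[OF X diff[OF yX] fX Df]] cg)
      show "\<forall>p\<in>T \<times> X. (\<lambda>(t, x). abs_det_deriv TYPE('d) X (?f t) x) (fst p, (\<lambda>(t, x). ?g t x) p) \<noteq> 0"
      proof
        fix p assume "p \<in> T \<times> X"
        then have "snd p \<in> X" by auto
        from inv[OF this, of "fst p"]
        show "(\<lambda>(t, x). abs_det_deriv TYPE('d) X (?f t) x) (fst p, (\<lambda>(t, x). ?g t x) p) \<noteq> 0"
          by (auto simp: case_prod_beta')
      qed
    qed (use maps in auto)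
    then show ?thesis
    proof (rule continuous_on_eq)
      fix p assume "p \<in> T \<times> X"
      then have "snd p \<in> X" by auto
      from inv[OF this, of "fst p"]
      show "1 / (\<lambda>(t, x). abs_det_deriv TYPE('d) X (?f t) x) (fst p, (\<lambda>(t, x). ?g t x) p)
          = (\<lambda>(t, x). ?J t x) p"
        unfolding case_prod_beta' fst_conv snd_conv
        by (metis eq_divide_eq mult_zero_right zero_neq_one)
    qed
  qed
  have fA: "?f t ` A \<in> sets \<nu>" if "A \<in> sets \<nu>" for t A
  proof -
    have "continuous_on X (?g t)"
      using diff[OF flow(1)[OF yX]] differentiable_imp_continuous_within continuous_on_eq_continuous_within by blast
    then have "X \<inter> ?g t -` A \<in> sets borel"
      using that XM nu_iff by (intro borel_continuous_preimage) auto
    moreover have "?f t ` A = X \<inter> ?g t -` A"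
    proof
      have AX: "A \<subseteq> X" using that nu_iff by blast
      show "?f t ` A \<subseteq> X \<inter> ?g t -` A" using maps(2)[OF subsetD[OF AX], of _ t] by auto
      show "X \<inter> ?g t -` A \<subseteq> ?f t ` A"
      proof
        fix x assume "x \<in> X \<inter> ?g t -` A"
        then have "x = ?f t (?g t x)" "?g t x \<in> A" using maps(1)[of x t] by auto
        then show "x \<in> ?f t ` A" by blast
      qed
    qed
    ultimately show ?thesis unfolding nu_iff by simp
  qed
  obtain C where C: "C \<ge> 0" "\<And>t A. t \<in> T \<Longrightarrow> A \<in> sets \<nu> \<Longrightarrow> emeasure \<nu> (?f t ` A) \<le> ennreal C * emeasure \<nu> A"
  proof -
    have "\<exists>C\<ge>0. \<forall>t\<in>T. \<forall>A\<in>sets \<nu>. emeasure \<nu> (?f t ` A) \<le> ennreal C * emeasure \<nu> A"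
    proof (rule volume_image_bound[OF X \<nu> cT _ _ cf Df])
      show "?f t differentiable (at x within X)" if "x \<in> X" for t x by (rule diff[OF yX that])
      show "?f t ` X \<subseteq> X" for t by (rule fX)
      show "?f t ` A \<in> sets \<nu>" if "A \<in> sets \<nu>" for t A by (rule fA[OF that])
    qed
    then show ?thesis using that by blast
  qed
  have C\<mu>: "emeasure ?\<mu> (?f t ` A) \<le> ennreal C * emeasure ?\<mu> A" if "t \<in> T" "A \<in> sets ?\<mu>" for t A
  proof -
    have A: "A \<in> sets \<nu>" "A \<subseteq> X" "?f t ` A \<subseteq> X"
      using that(2) nu_iff[of A] fA[of A t] nu_iff[of "?f t ` A"] by simp_all
    then show ?thesis
      using divide_right_mono_ennreal[OF C(2)[OF that(1) A(1)], of "emeasure \<nu> X"] fA[OF A(1)] XM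
      by (simp add: Int_absorb1 ennreal_times_divide)
  qed
  have NT: "N \<in> T" by (simp add: T_def)
  have fA\<mu>: "?f t ` A \<in> sets ?\<mu>" if "A \<in> sets ?\<mu>" for t A using fA that by simp
  have core: "t \<in> T \<Longrightarrow> integrable m (\<lambda>x. indicator (B j) (?g t x) * ?J t x)"
    "((\<lambda>t. LINT x:B i|m. indicator (B j) (?g t x) * ?J t x) \<longlongrightarrow>
      (LINT x:B i|m. indicator (B j) (?g N x) * ?J N x)) (at N within T)" for i j t
  proof -
    note Bm' = Bm(1)[unfolded m]
    note * = transported_set_integral[OF prob sets_\<mu> cX cT NT cg cJ, of ?f C "B j" "B i"]
    show "t \<in> T \<Longrightarrow> integrable m (\<lambda>x. indicator (B j) (?g t x) * ?J t x)"
      unfolding m by (rule *(1)) (assumption | rule maps fA\<mu> C(1) C\<mu> Bm')+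
    show "((\<lambda>t. LINT x:B i|m. indicator (B j) (?g t x) * ?J t x) \<longlongrightarrow>
      (LINT x:B i|m. indicator (B j) (?g N x) * ?J N x)) (at N within T)"
      unfolding m by (rule *(2)) (assumption | rule maps fA\<mu> C(1) C\<mu> Bm')+
  qed
  \<comment> \<open>The initial coefficients \<open>c0\<close> belong to the state \<open>y\<close>, so \<open>\<delta>\<close> enters only through the elapsed time.\<close>
  define c0 where "c0 = u M y"
  define c where "c t = (\<chi> i. (LINT x:B i|m. step_function B c0 (?g t x) * ?J t x) / measure m (B i))" for t
  have fhat: "f_hat TYPE('d) X m B \<xi> \<phi> u (\<xi> \<delta> z) M (N + \<delta>) = step_function B (c (N + \<delta>))" for \<delta>
  proof -
    have "\<xi> (- (N + \<delta>)) (\<xi> \<delta> z) = y" unfolding y_def using flow(3)[OF assms(9)] by simp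
    then show ?thesis
      unfolding f_hat_def step_projection_def perron_frobenius_def c_def c0_def by simp
  qed
  have fhat0: "f_hat TYPE('d) X m B \<xi> \<phi> u z M N = step_function B (c N)"
    using fhat[of 0] flow(2)[OF assms(9)] by simp
  have lim: "((\<lambda>t. c t $ i) \<longlongrightarrow> c N $ i) (at N within T)" for i
  proof -
    let ?I = "\<lambda>t j. LINT x:B i|m. indicator (B j) (?g t x) * ?J t x"
    have eq: "c t $ i = (\<Sum>j\<in>UNIV. c0 $ j * ?I t j) / measure m (B i)" if t: "t \<in> T" for t
    proof -
      have int: "integrable m (\<lambda>x. indicator (B i) x * (indicator (B j) (?g t x) * ?J t x))" for j
        using integrable_mult_indicator[OF Bm(1) core(1)[OF t]] by simp
      have "(LINT x:B i|m. step_function B c0 (?g t x) * ?J t x)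
          = (LINT x|m. (\<Sum>j\<in>UNIV. c0 $ j * (indicator (B i) x * (indicator (B j) (?g t x) * ?J t x))))"
        unfolding set_lebesgue_integral_def step_function_def
        by (simp only: real_scaleR_def sum_distrib_left sum_distrib_right mult_ac)
      also have "\<dots> = (\<Sum>j\<in>UNIV. c0 $ j * ?I t j)"
        unfolding set_lebesgue_integral_def
        by (subst Bochner_Integration.integral_sum) (auto intro: int integrable_mult_right)
      finally show ?thesis unfolding c_def by simp
    qed
    have "((\<lambda>t. (\<Sum>j\<in>UNIV. c0 $ j * ?I t j) / measure m (B i)) \<longlongrightarrow>
        (\<Sum>j\<in>UNIV. c0 $ j * ?I N j) / measure m (B i)) (at N within T)"
      using Bm(2)[of i] by (intro tendsto_intros core(2)) auto
    moreover have "\<forall>\<^sub>F t in at N within T. (\<Sum>j\<in>UNIV. c0 $ j * ?I t j) / measure m (B i) = c t $ i"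
      using eq by (simp add: eventually_at_filter)
    ultimately show ?thesis using eq[OF NT] by (simp add: tendsto_cong)
  qed
  have "at N within T = at N" unfolding T_def by (rule at_within_interior) simp
  moreover have "filterlim (\<lambda>\<delta>. N + \<delta>) (at N) (at_right 0)"
  proof -
    have "((\<lambda>\<delta>. N + \<delta>) \<longlongrightarrow> N + 0) (at_right 0)" by (intro tendsto_intros)
    moreover have "\<forall>\<^sub>F \<delta> in at_right 0. N + \<delta> \<noteq> N" by (simp add: eventually_at_filter)
    ultimately show ?thesis by (simp add: filterlim_at)
  qed
  ultimately have lim': "((\<lambda>\<delta>. c (N + \<delta>) $ i) \<longlongrightarrow> c N $ i) (at_right 0)" for i
    using filterlim_compose[OF lim[of i]] by simp
  have bound: "L1_norm m (\<lambda>x. step_function B (c (N + \<delta>)) x - step_function B (c N) x)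
      \<le> (\<Sum>i\<in>UNIV. \<bar>c (N + \<delta>) $ i - c N $ i\<bar> * measure m (B i))" for \<delta>
    by (rule L1_norm_step_function_diff_le[OF m.finite_measure_axioms Bm(1)])
  have "((\<lambda>\<delta>. \<Sum>i\<in>UNIV. \<bar>c (N + \<delta>) $ i - c N $ i\<bar> * measure m (B i)) \<longlongrightarrow>
      (\<Sum>i\<in>UNIV. \<bar>c N $ i - c N $ i\<bar> * measure m (B i))) (at_right 0)"
    by (intro tendsto_intros lim')
  then have bound_lim: "((\<lambda>\<delta>. \<Sum>i\<in>UNIV. \<bar>c (N + \<delta>) $ i - c N $ i\<bar> * measure m (B i)) \<longlongrightarrow> 0) (at_right 0)"
    by simp
  show ?thesis
    unfolding fhat fhat0
  proof (rule tendsto_sandwich[OF _ _ tendsto_const bound_lim])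
    show "\<forall>\<^sub>F \<delta> in at_right 0. 0 \<le> L1_norm m (\<lambda>x. step_function B (c (N + \<delta>)) x - step_function B (c N) x)"
      by (simp add: L1_norm_def)
    show "\<forall>\<^sub>F \<delta> in at_right 0. L1_norm m (\<lambda>x. step_function B (c (N + \<delta>)) x - step_function B (c N) x)
        \<le> (\<Sum>i\<in>UNIV. \<bar>c (N + \<delta>) $ i - c N $ i\<bar> * measure m (B i))"
      by (simp add: bound)
  qed
qed

end
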